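(* Let $\mathcal{E}=\{(z,z+1): z\in\mathcal{Z}\}\cup\{(z,0): z\in\mathcal{Z}\setminus\{0\}\}$, and let $\lambda_{z,z'}:\mathcal{M}_1(\mathcal{Z})\to\mathbb{R}_+$, $(z,z')\in\mathcal{E}$, be given transition rates. Assume: (i) there exist positive constants $\overline{\lambda},\underline{\lambda}$ such that, for all $\xi\in\mathcal{M}_1(\mathcal{Z})$, $\frac{\underline{\lambda}}{z+1}\le\lambda_{z,z+1}(\xi)\le\frac{\overline{\lambda}}{z+1}$ for all $z\in\mathcal{Z}$ and $\underline{\lambda}\le\lambda_{z,0}(\xi)\le\overline{\lambda}$ for all $z\in\mathcal{Z}\setminus\{0\}$; (ii) the functions $(z+1)\lambda_{z,z+1}(\cdot)$, $z\in\mathcal{Z}$, and $\lambda_{z,0}(\cdot)$, $z\in\mathcal{Z}\setminus\{0\}$, are uniformly Lipschitz continuous on $(\mathcal{M}_1(\mathcal{Z}),d)$; (iii) the McKean-Vlasov equation $\dot\mu(t)=\Lambda^*_{\mu(t)}\mu(t)$ has a unique globally asymptotically stable equilibrium $\xi^*\in\mathcal{M}_1(\mathcal{Z})$; (iv) $\langle\xi^*,\vartheta\rangle<\infty$ and, for each $M>0$, $\lim_{t\to\infty}\sup_{\nu\in\mathscr{K}_M}\langle\mu_\nu(t),\vartheta\rangle=\langle\xi^*,\vartheta\rangle$. Then, for $\xi\in\mathcal{M}_1(\mathcal{Z})$, $V(\xi)<\infty$ if and only if $\xi\in\mathscr{K}$. Furthermore, for any $M>0$ there exists a constant $C_M>0$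 such that $\xi\in\mathscr{K}_M$ implies $V(\xi)\le C_M$.
   Context: $\mathcal{Z}=\{0,1,2,\dots\}$. $\mathcal{M}_1(\mathcal{Z})$ is the set of probability measures on $\mathcal{Z}$ with the total variation metric $d$. For $\xi\in\mathcal{M}_1(\mathcal{Z})$, $\Lambda_\xi$ is the rate matrix: $\Lambda_\xi(z,z')=\lambda_{z,z'}(\xi)$ if $(z,z')\in\mathcal{E}$, $0$ if $z'\ne z$ and $(z,z')\notin\mathcal{E}$, and $\Lambda_\xi(z,z)=-\sum_{z'\ne z}\lambda_{z,z'}(\xi)$; $\Lambda_\xi^*$ is its transpose. $\mu_\nu$ denotes the solution of the McKean-Vlasov equation $\dot\mu(t)=\Lambda^*_{\mu(t)}\mu(t)$ with $\mu(0)=\nu$. $\vartheta(z)=z\log z$ with $0\log0=0$; $\langle\xi,\vartheta\rangle=\sum_z\xi(z)\vartheta(z)$; $\mathscr{K}_M=\{\xi\in\mathcal{M}_1(\mathcal{Z}):\langle\xi,\vartheta\rangle\le M\}$; $\mathscr{K}=\bigcup_{M\ge1}\mathscr{K}_M$. $D([0,T],\mathcal{M}_1(\mathcal{Z}))$ is the space of right-continuous paths with left limits. Let $C_0(\mathcal{Z})$ be the finitely supported real functions on $\mathcal{Z}$, $\tau(u)=e^u-u-1$. For $\varphi\in D([0,T],\mathcal{M}_1(\mathcal{Z}))$ with $\varphi(0)=\nu$ and $t\mapsto\varphi_t$ absolutely continuous (i.e. each coordinate $t\mapsto\varphi_t(z)$ is absolutely continuous, with derivative $\dot\varphi_t(z)$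 for a.e. $t$), $$S_{[0,T]}(\varphi|\nu)=\int_{[0,T]}\sup_{\alpha\in C_0(\mathcal{Z})}\Big\{\langle\alpha,\dot\varphi_t-\Lambda^*_{\varphi_t}\varphi_t\rangle-\sum_{(z,z')\in\mathcal{E}}\tau(\alpha(z')-\alpha(z))\lambda_{z,z'}(\varphi_t)\varphi_t(z)\Big\}dt,$$ and $S_{[0,T]}(\varphi|\nu)=\infty$ otherwise. The quasipotential is $V(\xi)=\inf\{S_{[0,T]}(\varphi|\xi^* ):\varphi(0)=\xi^*,\ \varphi(T)=\xi,\ T>0\}$, the infimum being over all $T>0$ and $\varphi\in D([0,T],\mathcal{M}_1(\mathcal{Z}))$. *)

theory Defs
  imports "HOL-Probability.Probability"
begin

section \<open>Probability measures on the nonnegative integers\<close>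

definition tv_dist :: "nat pmf \<Rightarrow> nat pmf \<Rightarrow> real" where
  "tv_dist p q = (SUP A. \<bar>measure_pmf.prob p A - measure_pmf.prob q A\<bar>)"

text \<open>In Isabelle \<^prop>\<open>ln 0 = (0::real)\<close>, so the convention \<open>0 log 0 = 0\<close> is built in.\<close>

definition vtheta :: "nat \<Rightarrow> real" where
  "vtheta z = real z * ln (real z)"

definition vtheta_moment :: "nat pmf \<Rightarrow> ennreal" where
  "vtheta_moment p = (\<integral>\<^sup>+ z. ennreal (vtheta z) \<partial>measure_pmf p)"

definition KM :: "real \<Rightarrow> nat pmf set" where
  "KM M = {p. vtheta_moment p \<le> ennreal M}"

definition KK :: "nat pmf set" where
  "KK = (\<Union>M\<in>{1..}. KM M)"

section \<open>The interacting jump process and the McKean--Vlasov equation\<close>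

definition edges :: "(nat \<times> nat) set" where
  "edges = {(z, Suc z) | z. True} \<union> {(z, 0) | z. z \<noteq> 0}"

text \<open>
  A family of rates is a function \<open>lam\<close> where \<open>lam z z' \<xi>\<close> is the rate of the transition from \<open>z\<close>
  to \<open>z'\<close>. Only its values for \<open>(z, z') \<in> edges\<close> are ever used. There are no loops in
  \<^const>\<open>edges\<close> and each vertex has finitely many outgoing edges, so the diagonal entry of
  the rate matrix is a finite sum.
\<close>

definition rate_matrix :: "(nat \<Rightarrow> nat \<Rightarrow> nat pmf \<Rightarrow> real) \<Rightarrow> nat pmf \<Rightarrow> nat \<Rightarrow> nat \<Rightarrow> real" where
  "rate_matrix lam \<xi> z z' =
     (if z' = z then - (\<Sum>w\<in>{w. (z, w) \<in> edges}. lam z w \<xi>)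
      else if (z, z') \<in> edges then lam z z' \<xi>
      else 0)"

text \<open>The entry at \<open>z\<close> of \<open>\<Lambda>\<^sub>\<xi>\<^sup>* \<xi>\<close>, where \<open>\<Lambda>\<^sub>\<xi>\<^sup>*\<close> is the transposed rate matrix.\<close>

definition mv_field :: "(nat \<Rightarrow> nat \<Rightarrow> nat pmf \<Rightarrow> real) \<Rightarrow> nat pmf \<Rightarrow> nat \<Rightarrow> real" where
  "mv_field lam \<xi> z = (\<Sum>\<^sub>\<infinity>z'. rate_matrix lam \<xi> z' z * pmf \<xi> z')"

definition mv_solution ::
  "(nat \<Rightarrow> nat \<Rightarrow> nat pmf \<Rightarrow> real) \<Rightarrow> nat pmf \<Rightarrow> (real \<Rightarrow> nat pmf) \<Rightarrow> bool" where
  "mv_solution lam \<nu> \<mu> \<longleftrightarrow> \<mu> 0 = \<nu> \<and>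
     (\<forall>t\<ge>0. \<forall>z. ((\<lambda>s. pmf (\<mu> s) z) has_real_derivative mv_field lam (\<mu> t) z) (at t within {0..}))"

text \<open>
  The solution \<open>\<mu>\<^sub>\<nu>\<close>. For bounded rates that are Lipschitz in the total variation distance,
  uniformly over the edges, the solution exists and is unique on \<open>[0, \<infinity>)\<close>; negative times are
  irrelevant.
\<close>

definition mv_flow :: "(nat \<Rightarrow> nat \<Rightarrow> nat pmf \<Rightarrow> real) \<Rightarrow> nat pmf \<Rightarrow> real \<Rightarrow> nat pmf" where
  "mv_flow lam \<nu> = (SOME \<mu>. mv_solution lam \<nu> \<mu>)"

text \<open>Equilibrium, Lyapunov stability and global attraction.\<close>

definition glob_asymp_stable_equilibrium ::
  "(nat \<Rightarrow> nat \<Rightarrow> nat pmf \<Rightarrow> real) \<Rightarrow> nat pmf \<Rightarrow> bool" where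
  "glob_asymp_stable_equilibrium lam \<xi> \<longleftrightarrow>
     (\<forall>z. mv_field lam \<xi> z = 0) \<and>
     (\<forall>\<epsilon>>0. \<exists>\<delta>>0. \<forall>\<nu>. tv_dist \<nu> \<xi> < \<delta> \<longrightarrow> (\<forall>t\<ge>0. tv_dist (mv_flow lam \<nu> t) \<xi> < \<epsilon>)) \<and>
     (\<forall>\<nu>. ((\<lambda>t. tv_dist (mv_flow lam \<nu> t) \<xi>) \<longlongrightarrow> 0) at_top)"

section \<open>Paths, action functional and quasipotential\<close>

text \<open>
  Paths on \<open>[0, T]\<close> are functions on the whole real line of which only the values on
  \<open>[0, T]\<close> matter.
\<close>

definition cadlag_path :: "real \<Rightarrow> (real \<Rightarrow> nat pmf) \<Rightarrow> bool" where
  "cadlag_path T \<phi> \<longleftrightarrow>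
     (\<forall>t\<in>{0..<T}. ((\<lambda>s. tv_dist (\<phi> s) (\<phi> t)) \<longlongrightarrow> 0) (at_right t)) \<and>
     (\<forall>t\<in>{0<..T}. \<exists>p. ((\<lambda>s. tv_dist (\<phi> s) p) \<longlongrightarrow> 0) (at_left t))"

text \<open>
  Absolute continuity of a real function on \<open>[a, b]\<close>: the finite families of nonoverlapping closed
  subintervals are given by their lists of endpoints.
\<close>

definition abs_cont_on :: "real \<Rightarrow> real \<Rightarrow> (real \<Rightarrow> real) \<Rightarrow> bool" where
  "abs_cont_on a b f \<longleftrightarrow>
     (\<forall>\<epsilon>>0. \<exists>\<delta>>0. \<forall>(n::nat) u v.
        (\<forall>i<n. a \<le> u i \<and> u i \<le> v i \<and> v i \<le> b) \<and>
        (\<forall>i<n. \<forall>j<n. i \<noteq> j \<longrightarrow> {u i<..<v i} \<inter> {u j<..<v j} = {}) \<and>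
        (\<Sum>i<n. v i - u i) < \<delta>
        \<longrightarrow> (\<Sum>i<n. \<bar>f (v i) - f (u i)\<bar>) < \<epsilon>)"

text \<open>
  The second clause follows from the first by Lebesgue's differentiation theorem; it records that
  the derivatives occurring in the action exist for almost every time.
\<close>

definition abs_cont_path :: "real \<Rightarrow> (real \<Rightarrow> nat pmf) \<Rightarrow> bool" where
  "abs_cont_path T \<phi> \<longleftrightarrow>
     (\<forall>z. abs_cont_on 0 T (\<lambda>t. pmf (\<phi> t) z) \<and>
          (AE t in lborel. t \<in> {0<..<T} \<longrightarrow> (\<lambda>s. pmf (\<phi> s) z) differentiable (at t)))"

definition tau :: "real \<Rightarrow> real" where
  "tau u = exp u - u - 1"

definition C0 :: "(nat \<Rightarrow> real) set" where
  "C0 = {\<alpha>. finite {z. \<alpha> z \<noteq> 0}}"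

text \<open>The pairing of \<open>\<alpha> \<in> C0\<close> with an arbitrary real sequence.\<close>

definition pairing :: "(nat \<Rightarrow> real) \<Rightarrow> (nat \<Rightarrow> real) \<Rightarrow> real" where
  "pairing \<alpha> f = (\<Sum>z\<in>{z. \<alpha> z \<noteq> 0}. \<alpha> z * f z)"

text \<open>
  The integrand of the action, for a velocity \<open>d\<close> at the point \<open>\<xi>\<close>. Since \<open>\<alpha> = 0\<close> contributes the
  value 0, the truncation of negative values by \<^const>\<open>ennreal\<close> does not change the supremum.
\<close>

definition lagrangian ::
  "(nat \<Rightarrow> nat \<Rightarrow> nat pmf \<Rightarrow> real) \<Rightarrow> nat pmf \<Rightarrow> (nat \<Rightarrow> real) \<Rightarrow> ennreal" where
  "lagrangian lam \<xi> d =
     (SUP \<alpha>\<in>C0. ennreal (pairing \<alpha> (\<lambda>z. d z - mv_field lam \<xi> z)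
        - (\<Sum>\<^sub>\<infinity>(z, z')\<in>edges. tau (\<alpha> z' - \<alpha> z) * lam z z' \<xi> * pmf \<xi> z)))"

definition action ::
  "(nat \<Rightarrow> nat \<Rightarrow> nat pmf \<Rightarrow> real) \<Rightarrow> real \<Rightarrow> (real \<Rightarrow> nat pmf) \<Rightarrow> nat pmf \<Rightarrow> ennreal" where
  "action lam T \<phi> \<nu> =
     (if \<phi> 0 = \<nu> \<and> abs_cont_path T \<phi>
      then \<integral>\<^sup>+ t\<in>{0..T}. lagrangian lam (\<phi> t) (\<lambda>z. deriv (\<lambda>s. pmf (\<phi> s) z) t) \<partial>lborel
      else \<infinity>)"

definition quasipotential ::
  "(nat \<Rightarrow> nat \<Rightarrow> nat pmf \<Rightarrow> real) \<Rightarrow> nat pmf \<Rightarrow> nat pmf \<Rightarrow> ennreal" where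
  "quasipotential lam \<xi>s \<xi> =
     Inf {action lam T \<phi> \<xi>s | T \<phi>. T > 0 \<and> cadlag_path T \<phi> \<and> \<phi> 0 = \<xi>s \<and> \<phi> T = \<xi>}"

end

theory Submission
  imports Defs
begin

text \<open>
  If the action of a path from \<open>\<nu>\<close> to \<open>\<xi>\<close> is finite, test it with truncations of \<open>\<vartheta>\<close>. Its
  increments satisfy \<open>exp (\<vartheta> (z + 1) - \<vartheta> z) \<le> e (z + 1)\<close>, which the rate \<open>O(1 / (z + 1))\<close> compensates,
  and jumps to \<open>0\<close> only help; so \<open>\<langle>\<xi>, \<vartheta>\<rangle> \<le> \<langle>\<nu>, \<vartheta>\<rangle> + S + C T\<close>.

  Conversely, if \<open>\<langle>\<xi>, \<vartheta>\<rangle>\<close> is finite, draw \<open>(a, N)\<close> from \<open>\<nu> \<otimes> \<xi>\<close> and move a particle from \<open>a\<close> to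
  \<open>0\<close> in unit time and then up to \<open>N\<close> through all intermediate sites in unit time. For a single
  particle the cost is \<open>O(N log N + 1)\<close>. Bounding the rates from below by constants makes the expression
  inside the supremum defining the Lagrangian affine in the path, so the cost of the mixture is at most
  the mean cost \<open>O(\<langle>\<xi>, \<vartheta>\<rangle> + 1)\<close>.
\<close>

section \<open>Absolutely continuous functions\<close>

text \<open>Along a mixture the Lagrangian is not convex: each rate depends on the whole mixed
  measure. Replacing the rates in front of the exponentials by constants leaves an expression linear
  in the measure and adds a bounded cost per unit time. This is affordable because all particles
  share the horizon 2. The common horizon also forces a particle with target N to climb at speed N:
  sending mass at speed N over the edge out of k, with rate of order 1 / (k + 1), costs order N log
  (N (k + 1)) per unit time, hence N log N in all.

  In the other direction the paths are absolutely continuous only coordinate by coordinate, and the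
  integrand of the action is not shown to be measurable in time. So the increment of a finite
  combination of coordinates is computed as a Henstock-Kurzweil integral, and only the positive part
  of its derivative, which is measurable, is compared with the integrand.

  Both directions rest on \<open>u + tau u = exp u - 1\<close>, by which the McKean-Vlasov drift
  drops out of the Lagrangian.\<close>

lemma abs_cont_on_finite:
  fixes f :: "real \<Rightarrow> real"
  assumes "abs_cont_on a b f" "\<epsilon> > 0"
  shows "\<exists>\<delta>>0. \<forall>(I :: 'i set) u v.
        finite I \<and> (\<forall>i\<in>I. a \<le> u i \<and> u i \<le> v i \<and> v i \<le> b) \<and>
        (\<forall>i\<in>I. \<forall>j\<in>I. i \<noteq> j \<longrightarrow> {u i<..<v i} \<inter> {u j<..<v j} = {}) \<and>
        (\<Sum>i\<in>I. v i - u i) < \<delta> \<longrightarrow> (\<Sum>i\<in>I. \<bar>f (v i) - f (u i)\<bar>) < \<epsilon>"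
proof -
  from assms(1)[unfolded abs_cont_on_def, rule_format, OF assms(2)]
  obtain \<delta> where \<delta>1: "\<delta> > 0" and \<delta>2: "\<forall>(n::nat) u v.
        (\<forall>i<n. a \<le> u i \<and> u i \<le> v i \<and> v i \<le> b) \<and>
        (\<forall>i<n. \<forall>j<n. i \<noteq> j \<longrightarrow> {u i<..<v i} \<inter> {u j<..<v j} = {}) \<and>
        (\<Sum>i<n. v i - u i) < \<delta> \<longrightarrow> (\<Sum>i<n. \<bar>f (v i) - f (u i)\<bar>) < \<epsilon>"
    by (elim exE conjE)
  show ?thesis
  proof (intro exI[of _ \<delta>] conjI allI impI \<delta>1)
    fix I :: "'i set" and u v
    assume I: "finite I \<and> (\<forall>i\<in>I. a \<le> u i \<and> u i \<le> v i \<and> v i \<le> b) \<and>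
        (\<forall>i\<in>I. \<forall>j\<in>I. i \<noteq> j \<longrightarrow> {u i<..<v i} \<inter> {u j<..<v j} = {}) \<and>
        (\<Sum>i\<in>I. v i - u i) < \<delta>"
    \<comment> \<open>The definition admits only families indexed by an initial segment of the
      naturals, so \<open>I\<close> is enumerated. Later \<open>I\<close> is a set of tagged
      intervals.\<close>
    obtain h where h: "bij_betw h {..<card I} I"
      using ex_bij_betw_nat_finite[of I] I by (auto simp: atLeast0LessThan)
    have hI: "h i \<in> I" if "i < card I" for i
      using h that by (auto simp: bij_betw_def)
    have hinj: "h i \<noteq> h j" if "i < card I" "j < card I" "i \<noteq> j" for i j
      using h that by (auto simp: bij_betw_def inj_on_def)
    have "(\<Sum>i<card I. \<bar>f (v (h i)) - f (u (h i))\<bar>) < \<epsilon>"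
    proof (rule \<delta>2[rule_format, of "card I" "\<lambda>i. u (h i)" "\<lambda>i. v (h i)"], intro conjI)
      show "\<forall>i<card I. a \<le> u (h i) \<and> u (h i) \<le> v (h i) \<and> v (h i) \<le> b"
        using hI I by simp
      show "\<forall>i<card I. \<forall>j<card I. i \<noteq> j \<longrightarrow> {u (h i)<..<v (h i)} \<inter> {u (h j)<..<v (h j)} = {}"
        using hI hinj I by simp
      show "(\<Sum>i<card I. v (h i) - u (h i)) < \<delta>"
        using I sum.reindex_bij_betw[OF h, of "\<lambda>i. v i - u i"] by simp
    qed
    then show "(\<Sum>i\<in>I. \<bar>f (v i) - f (u i)\<bar>) < \<epsilon>"
      using sum.reindex_bij_betw[OF h, of "\<lambda>i. \<bar>f (v i) - f (u i)\<bar>"] by simp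
  qed
qed

lemma abs_cont_on_add:
  assumes "abs_cont_on a b f" "abs_cont_on a b g"
  shows "abs_cont_on a b (\<lambda>t. f t + g t)"
  unfolding abs_cont_on_def
proof (intro allI impI)
  fix \<epsilon> :: real assume "\<epsilon> > 0"
  then have e: "\<epsilon> / 2 > 0" by simp
  from abs_cont_on_finite[where 'i = "nat", OF assms(1) e]
  obtain d1 where d11: "d1 > 0" and d12: "\<forall>(I :: nat set) u v.
        finite I \<and> (\<forall>i\<in>I. a \<le> u i \<and> u i \<le> v i \<and> v i \<le> b) \<and>
        (\<forall>i\<in>I. \<forall>j\<in>I. i \<noteq> j \<longrightarrow> {u i<..<v i} \<inter> {u j<..<v j} = {}) \<and>
        (\<Sum>i\<in>I. v i - u i) < d1 \<longrightarrow> (\<Sum>i\<in>I. \<bar>f (v i) - f (u i)\<bar>) < \<epsilon> / 2"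
    by (elim exE conjE)
  from abs_cont_on_finite[where 'i = "nat", OF assms(2) e]
  obtain d2 where d21: "d2 > 0" and d22: "\<forall>(I :: nat set) u v.
        finite I \<and> (\<forall>i\<in>I. a \<le> u i \<and> u i \<le> v i \<and> v i \<le> b) \<and>
        (\<forall>i\<in>I. \<forall>j\<in>I. i \<noteq> j \<longrightarrow> {u i<..<v i} \<inter> {u j<..<v j} = {}) \<and>
        (\<Sum>i\<in>I. v i - u i) < d2 \<longrightarrow> (\<Sum>i\<in>I. \<bar>g (v i) - g (u i)\<bar>) < \<epsilon> / 2"
    by (elim exE conjE)
  show "\<exists>\<delta>>0. \<forall>(n::nat) u v.
        (\<forall>i<n. a \<le> u i \<and> u i \<le> v i \<and> v i \<le> b) \<and>
        (\<forall>i<n. \<forall>j<n. i \<noteq> j \<longrightarrow> {u i<..<v i} \<inter> {u j<..<v j} = {}) \<and>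
        (\<Sum>i<n. v i - u i) < \<delta>
        \<longrightarrow> (\<Sum>i<n. \<bar>f (v i) + g (v i) - (f (u i) + g (u i))\<bar>) < \<epsilon>"
  proof (intro exI[of _ "min d1 d2"] conjI allI impI)
    fix n :: nat and u v
    assume H: "(\<forall>i<n. a \<le> u i \<and> u i \<le> v i \<and> v i \<le> b) \<and>
        (\<forall>i<n. \<forall>j<n. i \<noteq> j \<longrightarrow> {u i<..<v i} \<inter> {u j<..<v j} = {}) \<and>
        (\<Sum>i<n. v i - u i) < min d1 d2"
    have "(\<Sum>i<n. \<bar>f (v i) + g (v i) - (f (u i) + g (u i))\<bar>)
        \<le> (\<Sum>i<n. \<bar>f (v i) - f (u i)\<bar> + \<bar>g (v i) - g (u i)\<bar>)"
      by (rule sum_mono) auto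
    also have "\<dots> = (\<Sum>i<n. \<bar>f (v i) - f (u i)\<bar>) + (\<Sum>i<n. \<bar>g (v i) - g (u i)\<bar>)"
      by (rule sum.distrib)
    also have "\<dots> < \<epsilon> / 2 + \<epsilon> / 2"
      using H by (intro add_strict_mono d12[rule_format] d22[rule_format]) auto
    finally show "(\<Sum>i<n. \<bar>f (v i) + g (v i) - (f (u i) + g (u i))\<bar>) < \<epsilon>" by simp
  qed (use d11 d21 in auto)
qed

lemma abs_cont_on_lipschitz:
  assumes "\<And>s t. a \<le> s \<Longrightarrow> s \<le> t \<Longrightarrow> t \<le> b \<Longrightarrow> \<bar>f t - f s\<bar> \<le> K * (t - s)"
  shows "abs_cont_on a b f"
  unfolding abs_cont_on_def
proof (intro allI impI)
  fix \<epsilon> :: real assume "\<epsilon> > 0"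
  show "\<exists>\<delta>>0. \<forall>(n::nat) u v.
        (\<forall>i<n. a \<le> u i \<and> u i \<le> v i \<and> v i \<le> b) \<and>
        (\<forall>i<n. \<forall>j<n. i \<noteq> j \<longrightarrow> {u i<..<v i} \<inter> {u j<..<v j} = {}) \<and>
        (\<Sum>i<n. v i - u i) < \<delta>
        \<longrightarrow> (\<Sum>i<n. \<bar>f (v i) - f (u i)\<bar>) < \<epsilon>"
  \<comment> \<open>\<open>K\<close> may be zero or negative, so \<open>\<bar>K\<bar> + 1\<close>
    serves as a positive Lipschitz constant.\<close>
  proof (intro exI[of _ "\<epsilon> / (\<bar>K\<bar> + 1)"] conjI allI impI)
    show "\<epsilon> / (\<bar>K\<bar> + 1) > 0" using \<open>\<epsilon> > 0\<close> by simp
    fix n :: nat and u v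
    assume H: "(\<forall>i<n. a \<le> u i \<and> u i \<le> v i \<and> v i \<le> b) \<and>
        (\<forall>i<n. \<forall>j<n. i \<noteq> j \<longrightarrow> {u i<..<v i} \<inter> {u j<..<v j} = {}) \<and>
        (\<Sum>i<n. v i - u i) < \<epsilon> / (\<bar>K\<bar> + 1)"
    have "(\<Sum>i<n. \<bar>f (v i) - f (u i)\<bar>) \<le> (\<Sum>i<n. (\<bar>K\<bar> + 1) * (v i - u i))"
    proof (rule sum_mono)
      fix i assume "i \<in> {..<n}"
      then have i: "a \<le> u i" "u i \<le> v i" "v i \<le> b" using H by auto
      have "K * (v i - u i) \<le> (\<bar>K\<bar> + 1) * (v i - u i)"
        using i by (intro mult_right_mono) auto
      then show "\<bar>f (v i) - f (u i)\<bar> \<le> (\<bar>K\<bar> + 1) * (v i - u i)"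
        using assms[OF i] by linarith
    qed
    also have "\<dots> = (\<bar>K\<bar> + 1) * (\<Sum>i<n. v i - u i)" by (simp add: sum_distrib_left)
    also have "\<dots> < (\<bar>K\<bar> + 1) * (\<epsilon> / (\<bar>K\<bar> + 1))"
      using H by (intro mult_strict_left_mono) auto
    finally show "(\<Sum>i<n. \<bar>f (v i) - f (u i)\<bar>) < \<epsilon>" by simp
  qed
qed

lemma abs_cont_on_cmult:
  assumes "abs_cont_on a b f"
  shows "abs_cont_on a b (\<lambda>t. c * f t)"
  unfolding abs_cont_on_def
proof (intro allI impI)
  fix \<epsilon> :: real assume "\<epsilon> > 0"
  then have e: "\<epsilon> / (\<bar>c\<bar> + 1) > 0" by simp
  from abs_cont_on_finite[where 'i = "nat", OF assms e]
  obtain d where d1: "d > 0" and d2: "\<forall>(I :: nat set) u v.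
        finite I \<and> (\<forall>i\<in>I. a \<le> u i \<and> u i \<le> v i \<and> v i \<le> b) \<and>
        (\<forall>i\<in>I. \<forall>j\<in>I. i \<noteq> j \<longrightarrow> {u i<..<v i} \<inter> {u j<..<v j} = {}) \<and>
        (\<Sum>i\<in>I. v i - u i) < d \<longrightarrow> (\<Sum>i\<in>I. \<bar>f (v i) - f (u i)\<bar>) < \<epsilon> / (\<bar>c\<bar> + 1)"
    by (elim exE conjE)
  show "\<exists>\<delta>>0. \<forall>(n::nat) u v.
        (\<forall>i<n. a \<le> u i \<and> u i \<le> v i \<and> v i \<le> b) \<and>
        (\<forall>i<n. \<forall>j<n. i \<noteq> j \<longrightarrow> {u i<..<v i} \<inter> {u j<..<v j} = {}) \<and>
        (\<Sum>i<n. v i - u i) < \<delta>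
        \<longrightarrow> (\<Sum>i<n. \<bar>c * f (v i) - c * f (u i)\<bar>) < \<epsilon>"
  proof (intro exI[of _ d] conjI allI impI d1)
    fix n :: nat and u v
    assume H: "(\<forall>i<n. a \<le> u i \<and> u i \<le> v i \<and> v i \<le> b) \<and>
        (\<forall>i<n. \<forall>j<n. i \<noteq> j \<longrightarrow> {u i<..<v i} \<inter> {u j<..<v j} = {}) \<and>
        (\<Sum>i<n. v i - u i) < d"
    let ?S = "\<Sum>i<n. \<bar>f (v i) - f (u i)\<bar>"
    have "(\<Sum>i<n. \<bar>c * f (v i) - c * f (u i)\<bar>) = \<bar>c\<bar> * ?S"
      by (simp add: sum_distrib_left abs_mult flip: right_diff_distrib)
    also have "\<dots> \<le> (\<bar>c\<bar> + 1) * ?S"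
      by (intro mult_right_mono sum_nonneg) auto
    also have "\<dots> < (\<bar>c\<bar> + 1) * (\<epsilon> / (\<bar>c\<bar> + 1))"
      using H by (intro mult_strict_left_mono d2[rule_format]) auto
    finally show "(\<Sum>i<n. \<bar>c * f (v i) - c * f (u i)\<bar>) < \<epsilon>" by simp
  qed
qed

lemma abs_cont_on_sum:
  assumes "finite S" "\<And>i. i \<in> S \<Longrightarrow> abs_cont_on a b (f i)"
  shows "abs_cont_on a b (\<lambda>t. \<Sum>i\<in>S. f i t)"
  using assms
proof (induction S rule: finite_induct)
  case empty
  then show ?case by (auto intro: abs_cont_on_lipschitz[where K = 0])
next
  case (insert x S)
  then show ?case by (simp add: abs_cont_on_add)
qed

section \<open>Fundamental theorem of calculus for absolutely continuous functions\<close>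

lemma sum_length_le_emeasure:
  fixes u v :: "'i \<Rightarrow> real"
  assumes "finite I" "\<And>i. i \<in> I \<Longrightarrow> u i \<le> v i" "\<And>i. i \<in> I \<Longrightarrow> {u i<..<v i} \<subseteq> U"
    "\<And>i j. \<lbrakk>i \<in> I; j \<in> I; i \<noteq> j\<rbrakk> \<Longrightarrow> {u i<..<v i} \<inter> {u j<..<v j} = {}" "U \<in> sets lebesgue"
  shows "ennreal (\<Sum>i\<in>I. v i - u i) \<le> emeasure lebesgue U"
proof -
  have "ennreal (\<Sum>i\<in>I. v i - u i) = (\<Sum>i\<in>I. ennreal (v i - u i))"
    using assms(2) by (intro sum_ennreal[symmetric]) auto
  also have "\<dots> = (\<Sum>i\<in>I. emeasure lebesgue {u i<..<v i})"
    using assms(2) by (intro sum.cong) auto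
  also have "\<dots> = emeasure lebesgue (\<Union>i\<in>I. {u i<..<v i})"
    using assms by (intro sum_emeasure) (auto simp: disjoint_family_on_def)
  also have "\<dots> \<le> emeasure lebesgue U"
    using assms by (intro emeasure_mono) auto
  finally show ?thesis .
qed

text \<open>The gauge treats the two kinds of tags differently. At a tag outside \<open>N\<close>,
  differentiability makes the increment of \<open>f\<close> close to length times derivative. The
  intervals with tag in \<open>N\<close> are forced into an open set of small measure, where
  absolute continuity makes the total increment small.\<close>

lemma has_integral_deriv_abs_cont:
  fixes f f' :: "real \<Rightarrow> real"
  assumes ab: "a \<le> b" and ac: "abs_cont_on a b f" and N: "negligible N"
    and der: "\<And>t. t \<in> {a..b} - N \<Longrightarrow> (f has_real_derivative f' t) (at t within {a..b})"
  shows "(f' has_integral (f b - f a)) {a..b}"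
proof -
  \<comment> \<open>Nothing is known about \<open>f'\<close> on \<open>N\<close>; the value 0 there
    leaves only the increments of \<open>f\<close> to estimate. The final spike restores
    \<open>f'\<close>.\<close>
  define g where "g t = (if t \<in> N then 0 else f' t)" for t
  have "(g has_integral (f b - f a)) {a..b}"
    unfolding has_integral_real
  proof (intro allI impI)
    fix e :: real assume "e > 0"
    \<comment> \<open>The total error off \<open>N\<close> is at most \<open>e1 * (b - a)\<close>,
      which must not exceed \<open>e / 2\<close>; the \<open>+ 1\<close> covers
      \<open>a = b\<close>.\<close>
    define e1 where "e1 = e / (2 * (b - a + 1))"
    have e1: "e1 > 0" using \<open>e > 0\<close> ab by (simp add: e1_def)
    from abs_cont_on_finite[where 'i = "real \<times> real set", OF ac half_gt_zero[OF \<open>e > 0\<close>]]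
  obtain \<delta> where \<delta>1: "\<delta> > 0" and \<delta>2: "\<forall>(I :: (real \<times> real set) set) u v.
        finite I \<and> (\<forall>i\<in>I. a \<le> u i \<and> u i \<le> v i \<and> v i \<le> b) \<and>
        (\<forall>i\<in>I. \<forall>j\<in>I. i \<noteq> j \<longrightarrow> {u i<..<v i} \<inter> {u j<..<v j} = {}) \<and>
        (\<Sum>i\<in>I. v i - u i) < \<delta> \<longrightarrow> (\<Sum>i\<in>I. \<bar>f (v i) - f (u i)\<bar>) < e / 2"
    by (elim exE conjE)
    have Nnull: "N \<in> null_sets lebesgue" using N by (simp add: negligible_iff_null_sets)
    obtain U where U: "open U" "N \<subseteq> U" "U - N \<in> lmeasurable" "emeasure lebesgue (U - N) < ennreal \<delta>"
      using sets_lebesgue_outer_open[of N \<delta>] \<delta>1 Nnull by blast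
    have emU: "emeasure lebesgue U < ennreal \<delta>"
      using U(4) emeasure_Diff_null_set[OF Nnull, of U] \<open>open U\<close> by simp
    have "\<exists>d>0. \<forall>y\<in>{a..b}. \<bar>y - x\<bar> < d \<longrightarrow> \<bar>f y - f x - (y - x) * f' x\<bar> \<le> e1 * \<bar>y - x\<bar>"
      if "x \<in> {a..b} - N" for x
      using der[OF that] e1
      unfolding has_field_derivative_def has_derivative_within_alt real_norm_def
      by (simp add: mult.commute)
    then obtain d where d: "\<And>x. x \<in> {a..b} - N \<Longrightarrow> d x > 0"
      "\<And>x y. x \<in> {a..b} - N \<Longrightarrow> y \<in> {a..b} \<Longrightarrow> \<bar>y - x\<bar> < d x
          \<Longrightarrow> \<bar>f y - f x - (y - x) * f' x\<bar> \<le> e1 * \<bar>y - x\<bar>"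
      by metis
    \<comment> \<open>On \<open>N\<close> the gauge is the open cover \<open>U\<close> of measure
      below \<open>\<delta>\<close>. The radius 1 outside \<open>{a..b}\<close> is a default, since
      all tags lie in \<open>{a..b}\<close>.\<close>
    define \<gamma> where "\<gamma> x = (if x \<in> N then U else ball x (if x \<in> {a..b} then d x else 1))" for x
    have G: "gauge \<gamma>"
      unfolding gauge_def \<gamma>_def using U d(1) by auto
    have R: "norm ((\<Sum>(x, K)\<in>p. measure lborel K *\<^sub>R g x) - (f b - f a)) < e"
      if p: "p tagged_division_of {a..b}" and fine: "\<gamma> fine p" for p
    proof -
      have finp: "finite p" using p by blast
      have K: "a \<le> Inf K \<and> Inf K \<le> x \<and> x \<le> Sup K \<and> Sup K \<le> b \<and> K = {Inf K..Sup K} \<and> K \<subseteq> \<gamma> x"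
        if xKp: "(x, K) \<in> p" for x K
      proof -
        obtain u v where uv: "K = cbox u v" using tagged_division_ofD(4)[OF p xKp] by blast
        have xK: "x \<in> K" and Kab: "K \<subseteq> {a..b}"
          using tagged_division_ofD(2,3)[OF p xKp] by auto
        have le: "u \<le> v" using xK uv by auto
        then have "Inf K = u" "Sup K = v" unfolding uv by auto
        moreover have "K \<subseteq> \<gamma> x" using fine xKp by (auto simp: fine_def)
        moreover have "a \<le> u" "v \<le> b" using Kab le unfolding uv by auto
        ultimately show ?thesis using xK uv by simp
      qed
      have disj: "{Inf (snd i)<..<Sup (snd i)} \<inter> {Inf (snd j)<..<Sup (snd j)} = {}"
        if "i \<in> p" "j \<in> p" "i \<noteq> j" for i j
      proof -
        have "interior (snd i) \<inter> interior (snd j) = {}"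
          using tagged_division_ofD(5)[OF p, of "fst i" "snd i" "fst j" "snd j"] that
          by (auto simp: prod_eq_iff)
        moreover have "interior (snd i) = {Inf (snd i)<..<Sup (snd i)}" if "i \<in> p" for i
          using K[of "fst i" "snd i"] that by (metis interior_atLeastAtMost_real prod.collapse)
        ultimately show ?thesis using that by simp
      qed
      have fba: "f b - f a = (\<Sum>(x, K)\<in>p. f (Sup K) - f (Inf K))"
        using additive_tagged_division_1[OF ab p, of f] by simp
      have ba: "b - a = (\<Sum>(x, K)\<in>p. Sup K - Inf K)"
        using additive_tagged_division_1[OF ab p, of "\<lambda>x. x"] by simp
      let ?P = "{i \<in> p. fst i \<in> N}"
      have null: "(\<Sum>i\<in>?P. \<bar>f (Sup (snd i)) - f (Inf (snd i))\<bar>) < e / 2"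
      proof (rule \<delta>2[rule_format, of ?P "\<lambda>i. Inf (snd i)" "\<lambda>i. Sup (snd i)"], intro conjI)
        show "finite ?P" using finp by simp
        have "ennreal (\<Sum>i\<in>?P. Sup (snd i) - Inf (snd i)) \<le> emeasure lebesgue U"
        proof (rule sum_length_le_emeasure)
          fix i assume i: "i \<in> ?P"
          then have "snd i \<subseteq> U" "snd i = {Inf (snd i)..Sup (snd i)}"
            using K[of "fst i" "snd i"] by (auto simp: \<gamma>_def)
          then show "{Inf (snd i)<..<Sup (snd i)} \<subseteq> U"
            by (metis greaterThanLessThan_subseteq_atLeastAtMost_iff order_refl order_trans)
          show "Inf (snd i) \<le> Sup (snd i)" using K[of "fst i" "snd i"] i by auto
        qed (use finp disj U in auto)
        then have "ennreal (\<Sum>i\<in>?P. Sup (snd i) - Inf (snd i)) < ennreal \<delta>"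
          using emU by (rule le_less_trans)
        then show "(\<Sum>i\<in>?P. Sup (snd i) - Inf (snd i)) < \<delta>"
          using \<delta>1 by (meson ennreal_leI not_le)
        next
        show "\<forall>i\<in>?P. a \<le> Inf (snd i) \<and> Inf (snd i) \<le> Sup (snd i) \<and> Sup (snd i) \<le> b"
          using K by fastforce
        show "\<forall>i\<in>?P. \<forall>j\<in>?P. i \<noteq> j \<longrightarrow> {Inf (snd i)<..<Sup (snd i)} \<inter> {Inf (snd j)<..<Sup (snd j)} = {}"
          using disj by auto
      qed
      have good: "\<bar>measure lborel (snd i) * g (fst i) - (f (Sup (snd i)) - f (Inf (snd i)))\<bar>
          \<le> e1 * (Sup (snd i) - Inf (snd i))" if i: "i \<in> p - ?P" for i
      proof -
        obtain x L where xL: "i = (x, L)" by fastforce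
        have xp: "(x, L) \<in> p" "x \<notin> N" using i xL by auto
        note k = K[OF xp(1)]
        have xab: "x \<in> {a..b} - N" using k xp(2) by auto
        have "Inf L \<in> L" "Sup L \<in> L" using k by (metis atLeastAtMost_iff order_refl order_trans)+
        then have "Inf L \<in> \<gamma> x" "Sup L \<in> \<gamma> x" using k by blast+
        then have "\<bar>Inf L - x\<bar> < d x" "\<bar>Sup L - x\<bar> < d x"
          using xab by (auto simp: \<gamma>_def dist_real_def)
        then have near: "\<bar>f (Inf L) - f x - (Inf L - x) * f' x\<bar> \<le> e1 * \<bar>Inf L - x\<bar>"
          "\<bar>f (Sup L) - f x - (Sup L - x) * f' x\<bar> \<le> e1 * \<bar>Sup L - x\<bar>"
          using d(2)[OF xab, of "Inf L"] d(2)[OF xab, of "Sup L"] k by auto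
        have total: "e1 * \<bar>Inf L - x\<bar> + e1 * \<bar>Sup L - x\<bar> = e1 * (Sup L - Inf L)"
          using k by (simp add: algebra_simps)
        have len: "measure lborel L = Sup L - Inf L"
          using k content_real[of "Inf L" "Sup L"] by simp
        \<comment> \<open>The increment over an interval is split at its tag, because
          differentiability at the tag compares only with the value at the tag.\<close>
        have split: "measure lborel L * g x - (f (Sup L) - f (Inf L))
          = (f (Inf L) - f x - (Inf L - x) * f' x) - (f (Sup L) - f x - (Sup L - x) * f' x)"
          unfolding len using xp(2) by (simp add: g_def algebra_simps)
        show ?thesis unfolding xL fst_conv snd_conv split using near total by linarith
      qed
      have "\<bar>(\<Sum>(x, K)\<in>p. measure lborel K *\<^sub>R g x) - (f b - f a)\<bar>
         = \<bar>\<Sum>i\<in>p. measure lborel (snd i) * g (fst i) - (f (Sup (snd i)) - f (Inf (snd i)))\<bar>"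
        unfolding fba by (simp add: sum_subtractf case_prod_unfold)
      also have "\<dots> \<le> (\<Sum>i\<in>p. \<bar>measure lborel (snd i) * g (fst i) - (f (Sup (snd i)) - f (Inf (snd i)))\<bar>)"
        by (rule sum_abs)
      also have "\<dots> = (\<Sum>i\<in>p - ?P. \<bar>measure lborel (snd i) * g (fst i) - (f (Sup (snd i)) - f (Inf (snd i)))\<bar>)
         + (\<Sum>i\<in>?P. \<bar>measure lborel (snd i) * g (fst i) - (f (Sup (snd i)) - f (Inf (snd i)))\<bar>)"
        using finp by (intro sum.subset_diff) auto
      also have "\<dots> \<le> (\<Sum>i\<in>p - ?P. e1 * (Sup (snd i) - Inf (snd i)))
         + (\<Sum>i\<in>?P. \<bar>f (Sup (snd i)) - f (Inf (snd i))\<bar>)"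
        by (intro add_mono sum_mono good) (auto simp: g_def)
      also have "(\<Sum>i\<in>p - ?P. e1 * (Sup (snd i) - Inf (snd i))) \<le> (\<Sum>i\<in>p. e1 * (Sup (snd i) - Inf (snd i)))"
      proof (rule sum_mono2)
        fix i assume "i \<in> p - (p - ?P)"
        then have "(fst i, snd i) \<in> p" by simp
        then have "Inf (snd i) \<le> Sup (snd i)" using K by (meson order_trans)
        then show "0 \<le> e1 * (Sup (snd i) - Inf (snd i))" using e1 by simp
      qed (use finp in auto)
      also have "\<dots> = e1 * (b - a)"
        unfolding ba by (simp add: sum_distrib_left case_prod_unfold)
      also have "e1 * (b - a) \<le> e / 2"
        using ab \<open>e > 0\<close> by (simp add: e1_def field_simps)
      finally show ?thesis using null by simp
    qed
    show "\<exists>\<gamma>. gauge \<gamma> \<and> (\<forall>p. p tagged_division_of {a..b} \<and> \<gamma> fine p \<longrightarrow>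
        norm ((\<Sum>(x, K)\<in>p. measure lborel K *\<^sub>R g x) - (f b - f a)) < e)"
      by (intro exI[of _ \<gamma>] conjI allI impI G) (elim conjE, rule R)
  qed
  then show ?thesis
    by (rule has_integral_spike[OF N, rotated]) (auto simp: g_def)
qed

text \<open>\<open>h\<close> may be non-measurable, so \<open>f'\<close> is not subtracted from it.
  The positive part of \<open>f'\<close> on \<open>{a..b}\<close> is Lebesgue measurable, lies
  almost everywhere below \<open>h\<close>, and has integral at least the increment of
  \<open>f\<close>.\<close>

lemma abs_cont_le_nn_integral:
  fixes f f' :: "real \<Rightarrow> real"
  assumes ab: "a \<le> b" and ac: "abs_cont_on a b f"
    and der: "AE t in lborel. t \<in> {a<..<b} \<longrightarrow> (f has_real_derivative f' t) (at t) \<and> ennreal (f' t) \<le> h t"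
  shows "ennreal (f b - f a) \<le> (\<integral>\<^sup>+ t\<in>{a..b}. h t \<partial>lborel)"
proof -
  obtain N0 where N0: "N0 \<in> null_sets lborel"
    "{t. \<not> (t \<in> {a<..<b} \<longrightarrow> (f has_real_derivative f' t) (at t) \<and> ennreal (f' t) \<le> h t)} \<subseteq> N0"
    using der unfolding eventually_ae_filter by auto
  \<comment> \<open>The hypothesis speaks of the open interval only, so the endpoints join the
    exceptional set.\<close>
  define N where "N = N0 \<union> {a, b}"
  have Nnull: "N \<in> null_sets lborel"
    unfolding N_def using N0(1) countable_imp_null_set_lborel[of "{a, b}"] by (intro null_sets.Un) auto
  have N: "negligible N"
    using Nnull by (simp add: negligible_iff_null_sets null_sets_completionI)
  have D: "(f has_real_derivative f' t) (at t) \<and> ennreal (f' t) \<le> h t" if "t \<in> {a..b} - N" for t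
  proof -
    have "t \<in> {a<..<b}" "t \<notin> N0" using that by (auto simp: N_def)
    then show ?thesis using N0(2) by blast
  qed
  have int: "(f' has_integral (f b - f a)) {a..b}"
    by (rule has_integral_deriv_abs_cont[OF ab ac N]) (use D in \<open>blast intro: DERIV_subset\<close>)
  define F where "F t = max 0 (f' t) * indicator {a..b} t" for t
  have meas: "(\<lambda>t. f' t * indicator {a..b} t) \<in> borel_measurable lebesgue"
    using has_integral_implies_lebesgue_measurable_real[OF int] .
  have F_eq: "F = (\<lambda>t. max 0 (f' t * indicator {a..b} t))"
    by (auto simp: F_def indicator_def)
  have F: "F \<in> borel_measurable lebesgue" unfolding F_eq using meas by measurable
  have le: "(\<integral>\<^sup>+ t. ennreal (F t) \<partial>lebesgue) \<le> (\<integral>\<^sup>+ t\<in>{a..b}. h t \<partial>lborel)"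
  proof -
    have "(\<integral>\<^sup>+ t. ennreal (F t) \<partial>lebesgue) \<le> (\<integral>\<^sup>+ t. h t * indicator {a..b} t \<partial>lebesgue)"
    proof (rule nn_integral_mono_AE)
      have "AE t in lebesgue. t \<notin> N"
        using N by (intro AE_not_in) (simp add: negligible_iff_null_sets)
      then show "AE t in lebesgue. ennreal (F t) \<le> h t * indicator {a..b} t"
        by eventually_elim
          (use D in \<open>auto simp: F_def indicator_def max_def ennreal_neg\<close>)
    qed
    then show ?thesis by (simp add: nn_integral_completion)
  qed
  show ?thesis
  \<comment> \<open>If the positive part has infinite integral, so has \<open>h\<close>. Otherwise
    it is Lebesgue integrable and its integral can be compared with the Henstock-Kurzweil integral
    of \<open>f'\<close>.\<close>
  proof (cases "(\<integral>\<^sup>+ t. ennreal (F t) \<partial>lebesgue) = \<infinity>")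
    case True
    then show ?thesis using le by (simp add: top_unique)
  next
    case False
    have iF: "integrable lebesgue F"
      using F False by (intro integrableI_nonneg) (auto simp: F_def less_top)
    have "(F has_integral (integral\<^sup>L lebesgue F)) UNIV"
      using has_integral_integral_lebesgue[OF iF] .
    moreover have "F = (\<lambda>t. if t \<in> {a..b} then max 0 (f' t) else 0)"
      by (auto simp: F_def)
    ultimately have iF': "((\<lambda>t. max 0 (f' t)) has_integral (integral\<^sup>L lebesgue F)) {a..b}"
      by (simp only: has_integral_restrict_UNIV)
    have "f b - f a \<le> integral\<^sup>L lebesgue F"
      by (rule has_integral_le[OF int iF']) auto
    then have "ennreal (f b - f a) \<le> ennreal (integral\<^sup>L lebesgue F)" by (rule ennreal_leI)
    also have "\<dots> = (\<integral>\<^sup>+ t. ennreal (F t) \<partial>lebesgue)"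
      using iF by (intro nn_integral_eq_integral[symmetric]) (auto simp: F_def)
    also note le
    finally show ?thesis .
  qed
qed

section \<open>The bracket in the Lagrangian\<close>

text \<open>Links the unordered sums in the definitions of the drift and the Lagrangian with
  expectations, in which mixtures are easy to handle. Boundedness of \<open>h\<close> gives absolute
  summability.\<close>

lemma has_sum_pmf_mult:
  fixes h :: "'a \<Rightarrow> real"
  assumes "\<And>z. \<bar>h z\<bar> \<le> B"
  shows "((\<lambda>z. h z * pmf p z) has_sum measure_pmf.expectation p h) UNIV"
proof -
  have "integrable (count_space UNIV) (\<lambda>z. B * pmf p z)"
    by (intro integrable_mult_right integrable_pmf)
  then have "integrable (count_space UNIV) (\<lambda>z. h z * pmf p z)"
    by (rule Bochner_Integration.integrable_bound)
      (auto simp: abs_mult intro!: mult_right_mono order_trans[OF assms])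
  then have abs: "Infinite_Set_Sum.abs_summable_on (\<lambda>z. h z * pmf p z) UNIV"
    by (simp add: Infinite_Set_Sum.abs_summable_on_def)
  then have "infsum (\<lambda>z. h z * pmf p z) UNIV = infsetsum (\<lambda>z. h z * pmf p z) UNIV"
    by (simp add: infsetsum_infsum)
  also have "\<dots> = measure_pmf.expectation p h"
    by (simp add: pmf_expectation_eq_infsetsum mult.commute)
  finally show ?thesis
    using abs_summable_summable[OF abs[unfolded abs_summable_equivalent[symmetric]]] by (simp add: has_sum_iff)
qed

text \<open>Edges are grouped by their source, so that a sum over all edges weighted by the mass of
  the source becomes an expectation.\<close>

definition edge_sum :: "(nat \<Rightarrow> nat \<Rightarrow> real) \<Rightarrow> nat \<Rightarrow> real" where
  "edge_sum F z = (\<Sum>w\<in>{w. (z, w) \<in> edges}. F z w)"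

lemma edge_sum: "edge_sum F z = F z (Suc z) + (if z = 0 then 0 else F z 0)"
proof -
  have "{w. (z, w) \<in> edges} = (if z = 0 then {Suc z} else {Suc z, 0})"
    by (auto simp: edges_def)
  then show ?thesis by (simp add: edge_sum_def)
qed

lemma abs_edge_sum_le:
  assumes "\<And>z'. (z, z') \<in> edges \<Longrightarrow> \<bar>F z z'\<bar> \<le> B"
  shows "\<bar>edge_sum F z\<bar> \<le> 2 * B"
proof -
  have "\<bar>F z (Suc z)\<bar> \<le> B" using assms by (simp add: edges_def)
  moreover have "z \<noteq> 0 \<Longrightarrow> \<bar>F z 0\<bar> \<le> B" using assms by (simp add: edges_def)
  ultimately show ?thesis by (cases "z = 0") (auto simp: edge_sum)
qed

text \<open>The upward edges and the edges into 0 are disjoint families, each parametrised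
  injectively by the source; on each the sum is an expectation of a bounded function.\<close>

lemma infsum_edges_pmf:
  assumes B: "\<And>z z'. (z, z') \<in> edges \<Longrightarrow> \<bar>F z z'\<bar> \<le> B"
  shows "(\<Sum>\<^sub>\<infinity>(z, z')\<in>edges. F z z' * pmf p z) = measure_pmf.expectation p (edge_sum F)"
proof -
  let ?U = "(\<lambda>z. (z, Suc z)) ` (UNIV :: nat set)" and ?D = "(\<lambda>z. (z, 0::nat)) ` {z::nat. z \<noteq> 0}"
  let ?f = "\<lambda>(z, z'). F z z' * pmf p z" and ?d = "\<lambda>z. if z = 0 then 0 else F z 0"
  have B0: "0 \<le> B" using B[of 0 1] by (auto simp: edges_def)
  have bu: "\<bar>F z (Suc z)\<bar> \<le> B" for z using B by (simp add: edges_def)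
  have bd: "\<bar>?d z\<bar> \<le> B" for z using B[of z 0] B0 by (simp add: edges_def)
  have "(?f has_sum measure_pmf.expectation p (\<lambda>z. F z (Suc z))) ?U"
    using has_sum_pmf_mult[OF bu] by (subst has_sum_reindex) (auto simp: inj_on_def o_def)
  moreover have "((\<lambda>z. ?d z * pmf p z) has_sum measure_pmf.expectation p ?d) UNIV"
    by (rule has_sum_pmf_mult[of ?d, OF bd])
  then have "((\<lambda>z. F z 0 * pmf p z) has_sum measure_pmf.expectation p ?d) {z. z \<noteq> 0}"
    by (rule iffD1[OF has_sum_cong_neutral, rotated -1]) auto
  then have "(?f has_sum measure_pmf.expectation p ?d) ?D"
    by (subst has_sum_reindex) (auto simp: inj_on_def o_def)
  ultimately have "(?f has_sum measure_pmf.expectation p (\<lambda>z. F z (Suc z)) + measure_pmf.expectation p ?d)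
      (?U \<union> ?D)"
    by (rule has_sum_Un_disjoint) auto
  moreover have "?U \<union> ?D = edges" by (auto simp: edges_def)
  moreover have "measure_pmf.expectation p (\<lambda>z. F z (Suc z)) + measure_pmf.expectation p ?d
      = measure_pmf.expectation p (edge_sum F)"
    unfolding edge_sum using bu bd
    by (subst Bochner_Integration.integral_add)
      (auto intro!: measure_pmf.integrable_const_bound[where B = B])
  ultimately show ?thesis by (simp add: infsumI)
qed

lemma C0_bounded:
  assumes "\<alpha> \<in> C0"
  shows "\<exists>B. \<forall>z. \<bar>\<alpha> z\<bar> \<le> B"
proof (intro exI allI)
  fix z
  have fin: "finite ((\<lambda>z. \<bar>\<alpha> z\<bar>) ` {z. \<alpha> z \<noteq> 0})" using assms by (simp add: C0_def)
  show "\<bar>\<alpha> z\<bar> \<le> Max (insert 0 ((\<lambda>z. \<bar>\<alpha> z\<bar>) ` {z. \<alpha> z \<noteq> 0}))"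
    using fin by (cases "\<alpha> z = 0") (auto intro!: Max_ge)
qed

lemma pairing_superset:
  assumes "finite S" "\<And>z. z \<notin> S \<Longrightarrow> \<alpha> z = 0"
  shows "pairing \<alpha> f = (\<Sum>z\<in>S. \<alpha> z * f z)"
  unfolding pairing_def using assms by (intro sum.mono_neutral_left) auto

section \<open>The Lagrangian under two-sided rate bounds\<close>

locale jump_rates =
  fixes lam :: "nat \<Rightarrow> nat \<Rightarrow> nat pmf \<Rightarrow> real" and lam_up lam_lo :: real
  assumes lam_lo_pos: "0 < lam_lo"
    and rate_up: "lam_lo / (real z + 1) \<le> lam z (Suc z) \<xi>" "lam z (Suc z) \<xi> \<le> lam_up / (real z + 1)"
    and rate_zero: "z \<noteq> 0 \<Longrightarrow> lam_lo \<le> lam z 0 \<xi>" "z \<noteq> 0 \<Longrightarrow> lam z 0 \<xi> \<le> lam_up"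
begin

lemma lam_up_pos: "0 < lam_up"
  using rate_zero[of 1] lam_lo_pos by (meson less_le_trans one_neq_zero order_trans)

lemma rate_le: "(z, z') \<in> edges \<Longrightarrow> lam z z' \<xi> \<le> lam_up"
proof (auto simp: edges_def rate_zero)
  have "lam_up / (real z + 1) \<le> lam_up / 1"
    using lam_up_pos by (intro divide_left_mono) auto
  then show "lam z (Suc z) \<xi> \<le> lam_up" using rate_up(2)[of z \<xi>] by simp
qed

lemma rate_nonneg: "(z, z') \<in> edges \<Longrightarrow> 0 \<le> lam z z' \<xi>"
proof (auto simp: edges_def)
  show "0 \<le> lam z (Suc z) \<xi>"
    using rate_up(1)[of z \<xi>] lam_lo_pos by (meson divide_nonneg_nonneg le_add_same_cancel1 less_imp_le of_nat_0_le_iff order_trans zero_le_one add_nonneg_nonneg)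
  show "0 < z \<Longrightarrow> 0 \<le> lam z 0 \<xi>"
    using rate_zero(1)[of z \<xi>] lam_lo_pos by simp
qed

lemma abs_rate_matrix_le: "\<bar>rate_matrix lam \<xi> z' z\<bar> \<le> 2 * lam_up"
proof -
  have "\<bar>edge_sum (\<lambda>z w. lam z w \<xi>) z'\<bar> \<le> 2 * lam_up"
    using rate_le rate_nonneg by (intro abs_edge_sum_le) (simp add: abs_of_nonneg)
  then show ?thesis
    using rate_le[of z' z \<xi>] rate_nonneg[of z' z \<xi>] lam_up_pos
    by (auto simp: rate_matrix_def edge_sum_def)
qed

lemma mv_field_eq: "mv_field lam \<xi> z = measure_pmf.expectation \<xi> (\<lambda>z'. rate_matrix lam \<xi> z' z)"
proof -
  from has_sum_pmf_mult[OF abs_rate_matrix_le] show ?thesis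
    unfolding mv_field_def by (rule infsumI)
qed

text \<open>The right-hand side is the generator of the jump process applied to
  \<open>\<alpha>\<close>: the diagonal entry of the row turns values of \<open>\<alpha>\<close> at
  the targets into increments.\<close>

lemma sum_rate_matrix:
  assumes "finite S" "\<And>z. z \<notin> S \<Longrightarrow> \<alpha> z = 0"
  shows "(\<Sum>z\<in>S. \<alpha> z * rate_matrix lam \<xi> z' z) = edge_sum (\<lambda>z w. (\<alpha> w - \<alpha> z) * lam z w \<xi>) z'"
proof -
  have d: "(\<Sum>z\<in>S. \<alpha> z * (if z = w then c else 0)) = \<alpha> w * c" for w c
    using assms by (cases "w \<in> S") (auto simp: if_distrib cong: if_cong)
  \<comment> \<open>A row has at most three nonzero entries: the upward target, the target 0 and the
    diagonal. For \<open>z' = 0\<close> the target 0 coincides with the diagonal, which explains the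
    inner case distinction.\<close>
  have "\<alpha> z * rate_matrix lam \<xi> z' z = \<alpha> z * (if z = Suc z' then lam z' (Suc z') \<xi> else 0)
     + \<alpha> z * (if z = 0 then (if z' = 0 then 0 else lam z' 0 \<xi>) else 0)
     - \<alpha> z * (if z = z' then edge_sum (\<lambda>z w. lam z w \<xi>) z' else 0)" for z
    unfolding rate_matrix_def edge_sum_def[of "\<lambda>z w. lam z w \<xi>", symmetric] by (auto simp: edges_def)
  then show ?thesis
    by (simp only: sum.distrib sum_subtractf d) (auto simp: edge_sum algebra_simps)
qed

text \<open>Duality between the rate matrix and its transpose. Finite support of
  \<open>\<alpha>\<close> allows the sum and the expectation to be exchanged.\<close>

lemma pairing_mv_field:
  assumes "\<alpha> \<in> C0"
  shows "pairing \<alpha> (mv_field lam \<xi>)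
    = measure_pmf.expectation \<xi> (edge_sum (\<lambda>z w. (\<alpha> w - \<alpha> z) * lam z w \<xi>))"
proof -
  let ?S = "{z. \<alpha> z \<noteq> 0}"
  have fin: "finite ?S" using assms by (simp add: C0_def)
  have int: "integrable (measure_pmf \<xi>) (\<lambda>z'. rate_matrix lam \<xi> z' z)" for z
    by (intro measure_pmf.integrable_const_bound[where B = "2 * lam_up"]) (auto simp: abs_rate_matrix_le)
  have "pairing \<alpha> (mv_field lam \<xi>) = (\<Sum>z\<in>?S. measure_pmf.expectation \<xi> (\<lambda>z'. \<alpha> z * rate_matrix lam \<xi> z' z))"
    by (simp add: pairing_def mv_field_eq)
  also have "\<dots> = measure_pmf.expectation \<xi> (\<lambda>z'. \<Sum>z\<in>?S. \<alpha> z * rate_matrix lam \<xi> z' z)"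
    using int by (intro Bochner_Integration.integral_sum[symmetric] integrable_mult_right)
  also have "\<dots> = measure_pmf.expectation \<xi> (edge_sum (\<lambda>z w. (\<alpha> w - \<alpha> z) * lam z w \<xi>))"
    by (subst sum_rate_matrix[OF fin]) auto
  finally show ?thesis .
qed

text \<open>\<open>\<alpha>\<close> is bounded, so its increments stay in a compact interval, on
  which \<open>f\<close> is bounded. It is applied to the identity, to \<open>tau\<close> and to
  \<open>exp u - 1\<close>.\<close>

lemma bounded_edge_function:
  assumes \<alpha>: "\<alpha> \<in> C0" and f: "\<And>b. \<exists>c. \<forall>u. \<bar>u\<bar> \<le> b \<longrightarrow> \<bar>f u\<bar> \<le> c"
  shows "\<exists>B. \<forall>z w. (z, w) \<in> edges \<longrightarrow> \<bar>f (\<alpha> w - \<alpha> z) * lam z w \<xi>\<bar> \<le> B"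
proof -
  from C0_bounded[OF \<alpha>] obtain b where b: "\<forall>z. \<bar>\<alpha> z\<bar> \<le> b" by (elim exE)
  from f[of "2 * b"] obtain c where c: "\<forall>u. \<bar>u\<bar> \<le> 2 * b \<longrightarrow> \<bar>f u\<bar> \<le> c" by (elim exE)
  have c': "\<bar>f (\<alpha> w - \<alpha> z)\<bar> \<le> c" for z w
    using b[rule_format, of z] b[rule_format, of w] by (intro c[rule_format]) linarith
  have "0 \<le> c" using c'[of 0 0] by linarith
  then have "\<bar>f (\<alpha> w - \<alpha> z) * lam z w \<xi>\<bar> \<le> c * lam_up" if "(z, w) \<in> edges" for z w
    using c' rate_le[OF that] rate_nonneg[OF that] by (auto simp: abs_mult intro!: mult_mono)
  then show ?thesis by (intro exI[of _ "c * lam_up"]) simp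
qed

lemma integrable_edge_sum:
  assumes \<alpha>: "\<alpha> \<in> C0" and f: "\<And>b. \<exists>c. \<forall>u. \<bar>u\<bar> \<le> b \<longrightarrow> \<bar>f u\<bar> \<le> c"
  shows "integrable (measure_pmf \<xi>) (edge_sum (\<lambda>z w. f (\<alpha> w - \<alpha> z) * lam z w \<xi>))"
proof -
  from bounded_edge_function[OF \<alpha> f, of \<xi>]
  obtain B where B: "\<forall>z w. (z, w) \<in> edges \<longrightarrow> \<bar>f (\<alpha> w - \<alpha> z) * lam z w \<xi>\<bar> \<le> B"
    by (elim exE)
  have "\<bar>edge_sum (\<lambda>z w. f (\<alpha> w - \<alpha> z) * lam z w \<xi>) z\<bar> \<le> 2 * B" for z
    by (rule abs_edge_sum_le) (simp add: B)
  then show ?thesis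
    by (intro measure_pmf.integrable_const_bound[where B = "2 * B"]) auto
qed

lemma integrable_exp_edge_sum:
  assumes "\<alpha> \<in> C0"
  shows "integrable (measure_pmf \<xi>) (edge_sum (\<lambda>z w. (exp (\<alpha> w - \<alpha> z) - 1) * lam z w \<xi>))"
proof (rule integrable_edge_sum[OF assms])
  fix b :: real
  show "\<exists>c. \<forall>u. \<bar>u\<bar> \<le> b \<longrightarrow> \<bar>exp u - 1\<bar> \<le> c"
  proof (intro exI allI impI)
    fix u :: real assume "\<bar>u\<bar> \<le> b"
    then have "exp u \<le> exp b" by auto
    then show "\<bar>exp u - 1\<bar> \<le> exp b + 1" using exp_gt_zero[of u] by linarith
  qed
qed

text \<open>By duality the drift contributes the increments of \<open>\<alpha>\<close>, and
  \<open>u + tau u = exp u - 1\<close>. What remains is the velocity tested against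
  \<open>\<alpha>\<close> minus one exponential term, the form used for both the upper and the lower
  bound.\<close>

lemma lagrangian_bracket:
  assumes \<alpha>: "\<alpha> \<in> C0"
  shows "pairing \<alpha> (\<lambda>z. d z - mv_field lam \<xi> z)
        - (\<Sum>\<^sub>\<infinity>(z, z')\<in>edges. tau (\<alpha> z' - \<alpha> z) * lam z z' \<xi> * pmf \<xi> z)
      = pairing \<alpha> d - measure_pmf.expectation \<xi> (edge_sum (\<lambda>z w. (exp (\<alpha> w - \<alpha> z) - 1) * lam z w \<xi>))"
proof -
  have id: "\<exists>c. \<forall>u. \<bar>u\<bar> \<le> b \<longrightarrow> \<bar>u\<bar> \<le> c" for b :: real by blast
  have tau: "\<exists>c. \<forall>u. \<bar>u\<bar> \<le> b \<longrightarrow> \<bar>tau u\<bar> \<le> c" for b :: real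
  proof (intro exI allI impI)
    fix u :: real assume u: "\<bar>u\<bar> \<le> b"
    then have "exp u \<le> exp b" by auto
    then show "\<bar>tau u\<bar> \<le> exp b + b + 1"
      unfolding tau_def using u exp_gt_zero[of u] by linarith
  qed
  from bounded_edge_function[OF \<alpha> tau, of \<xi>]
  obtain B where B: "\<forall>z w. (z, w) \<in> edges \<longrightarrow> \<bar>tau (\<alpha> w - \<alpha> z) * lam z w \<xi>\<bar> \<le> B"
    by (elim exE)
  note int = integrable_edge_sum[OF \<alpha> id, of \<xi>] and int' = integrable_edge_sum[OF \<alpha> tau, of \<xi>]
  have edges_sum: "(\<Sum>\<^sub>\<infinity>(z, z')\<in>edges. tau (\<alpha> z' - \<alpha> z) * lam z z' \<xi> * pmf \<xi> z)
      = measure_pmf.expectation \<xi> (edge_sum (\<lambda>z w. tau (\<alpha> w - \<alpha> z) * lam z w \<xi>))"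
    by (rule infsum_edges_pmf[of "\<lambda>z w. tau (\<alpha> w - \<alpha> z) * lam z w \<xi>" B]) (simp add: B)
  have "pairing \<alpha> (\<lambda>z. d z - mv_field lam \<xi> z) = pairing \<alpha> d - pairing \<alpha> (mv_field lam \<xi>)"
    by (simp add: pairing_def right_diff_distrib sum_subtractf)
  moreover have "measure_pmf.expectation \<xi> (edge_sum (\<lambda>z w. (\<alpha> w - \<alpha> z) * lam z w \<xi>))
      + measure_pmf.expectation \<xi> (edge_sum (\<lambda>z w. tau (\<alpha> w - \<alpha> z) * lam z w \<xi>))
      = measure_pmf.expectation \<xi> (edge_sum (\<lambda>z w. (exp (\<alpha> w - \<alpha> z) - 1) * lam z w \<xi>))"
    by (subst Bochner_Integration.integral_add[OF int int', symmetric])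
      (auto simp: edge_sum tau_def algebra_simps intro!: Bochner_Integration.integral_cong)
  ultimately show ?thesis
    unfolding pairing_mv_field[OF \<alpha>] edges_sum by simp
qed

text \<open>One test function bounds the supremum from below. The growth condition makes the
  exponential term bounded uniformly in \<open>\<xi>\<close> and in \<open>\<alpha>\<close>, so the
  constant survives the removal of a truncation.\<close>

lemma lagrangian_ge:
  assumes \<alpha>: "\<alpha> \<in> C0" and incr: "\<And>z. \<alpha> (Suc z) - \<alpha> z \<le> ln (real z + 1) + 1"
    and "\<alpha> 0 = 0" "\<And>z. 0 \<le> \<alpha> z"
  shows "ennreal (pairing \<alpha> d - exp 1 * lam_up) \<le> lagrangian lam \<xi> d"
proof -
  have "edge_sum (\<lambda>z w. (exp (\<alpha> w - \<alpha> z) - 1) * lam z w \<xi>) z \<le> exp 1 * lam_up" for z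
  proof -
    have "exp (\<alpha> (Suc z) - \<alpha> z) \<le> exp (ln (real z + 1) + 1)" using incr by simp
    also have "\<dots> = (real z + 1) * exp 1" by (simp add: exp_add)
    finally have "(exp (\<alpha> (Suc z) - \<alpha> z) - 1) * lam z (Suc z) \<xi> \<le> ((real z + 1) * exp 1) * (lam_up / (real z + 1))"
      using rate_up(2)[of z \<xi>] rate_nonneg[of z "Suc z" \<xi>]
      by (intro mult_mono) (auto simp: edges_def)
    moreover have "z \<noteq> 0 \<Longrightarrow> (exp (\<alpha> 0 - \<alpha> z) - 1) * lam z 0 \<xi> \<le> 0"
      using assms rate_nonneg[of z 0 \<xi>] by (intro mult_nonpos_nonneg) (auto simp: edges_def)
    ultimately show ?thesis by (auto simp: edge_sum add_nonneg_eq_0_iff)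
  qed
  then have "measure_pmf.expectation \<xi> (edge_sum (\<lambda>z w. (exp (\<alpha> w - \<alpha> z) - 1) * lam z w \<xi>)) \<le> exp 1 * lam_up"
    by (intro measure_pmf.integral_le_const integrable_exp_edge_sum[OF \<alpha>]) auto
  then show ?thesis
    unfolding lagrangian_def
    by (intro SUP_upper2[OF \<alpha>] ennreal_leI, subst lagrangian_bracket[OF \<alpha>]) auto
qed

end

section \<open>Finite action implies finite moment\<close>

lemma vtheta_nonneg: "0 \<le> vtheta z"
  by (cases "z = 0") (auto simp: vtheta_def)

text \<open>The increment equals log (z + 1) + z log (1 + 1 / z), and log (1 + x) is at most
  x.\<close>

lemma vtheta_increment: "vtheta (Suc z) - vtheta z \<le> ln (real z + 1) + 1"
proof (cases "z = 0")
  case True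
  then show ?thesis by (simp add: vtheta_def)
next
  case False
  have "real z * (ln (real z + 1) - ln (real z)) = real z * ln ((real z + 1) / real z)"
    using False by (subst ln_div) auto
  also have "\<dots> = real z * ln (1 + 1 / real z)" using False by (simp add: add_divide_distrib)
  also have "\<dots> \<le> real z * (1 / real z)" by (intro mult_left_mono ln_add_one_self_le_self) auto
  also have "\<dots> = 1" using False by simp
  finally show ?thesis by (simp add: vtheta_def algebra_simps)
qed

text \<open>Finitely supported test functions see only the partial sums; a bound uniform in
  \<open>n\<close> then passes to the full moment.\<close>

lemma vtheta_moment_eq_SUP:
  "vtheta_moment p = (SUP n. ennreal (\<Sum>z<n. vtheta z * pmf p z))"
proof -
  have "vtheta_moment p = (\<integral>\<^sup>+ z. ennreal (vtheta z * pmf p z) \<partial>count_space UNIV)"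
    unfolding vtheta_moment_def nn_integral_measure_pmf
    by (simp add: vtheta_nonneg ennreal_mult' mult.commute)
  also have "\<dots> = (SUP n. \<Sum>z<n. ennreal (vtheta z * pmf p z))"
    by (simp add: nn_integral_count_space_nat suminf_eq_SUP)
  also have "\<dots> = (SUP n. ennreal (\<Sum>z<n. vtheta z * pmf p z))"
    by (simp add: vtheta_nonneg)
  finally show ?thesis .
qed

lemma ennreal_le_diff_plus:
  assumes "0 \<le> y"
  shows "ennreal x \<le> ennreal (x - y) + ennreal y"
proof (cases "y \<le> x")
  case True
  then show ?thesis using assms by (simp flip: ennreal_plus)
next
  case False
  then show ?thesis by (simp add: ennreal_neg ennreal_leI)
qed

context jump_rates
begin

text \<open>Testing with truncated \<open>\<vartheta>\<close> shows that the truncated moment, less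
  its admissible linear growth, increases by at most the action. The bound does not depend on
  \<open>n\<close>.\<close>

lemma truncated_moment_le_action:
  assumes T: "0 \<le> T"
  shows "ennreal (\<Sum>z<n. vtheta z * pmf (\<phi> T) z)
    \<le> vtheta_moment \<nu> + action lam T \<phi> \<nu> + ennreal (exp 1 * lam_up * T)"
proof (cases "\<phi> 0 = \<nu> \<and> abs_cont_path T \<phi>")
  case False
  then show ?thesis by (auto simp: action_def)
next
  case True
  \<comment> \<open>Cutting to 0 keeps \<open>\<alpha>\<close> finitely supported. The drop at the
    cut is a negative increment, hence compatible with the growth condition.\<close>
  define \<alpha> where "\<alpha> z = (if z < n then vtheta z else 0)" for z
  have pair: "pairing \<alpha> d = (\<Sum>z<n. vtheta z * d z)" for d
    by (subst pairing_superset[of "{..<n}"]) (auto simp: \<alpha>_def)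
  have \<alpha>: "\<alpha> \<in> C0"
    unfolding C0_def by (auto simp: \<alpha>_def intro: finite_subset[of _ "{..<n}"])
  let ?C = "exp 1 * lam_up"
  let ?m = "\<lambda>t. \<Sum>z<n. vtheta z * pmf (\<phi> t) z"
  let ?f = "\<lambda>t. ?m t + (- ?C) * t"
  let ?d = "\<lambda>t z. deriv (\<lambda>s. pmf (\<phi> s) z) t"
  have C: "0 \<le> ?C" using lam_up_pos by simp
  have "\<alpha> (Suc z) - \<alpha> z \<le> ln (real z + 1) + 1" for z
  proof -
    have "0 \<le> ln (real z + 1)" by simp
    then have "- vtheta z \<le> ln (real z + 1) + 1" "0 \<le> ln (real z + 1) + 1"
      using vtheta_nonneg[of z] by linarith+
    then show ?thesis
      using vtheta_increment[of z] by (auto simp: \<alpha>_def)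
  qed
  then have lag: "ennreal (pairing \<alpha> d - ?C) \<le> lagrangian lam \<xi> d" for \<xi> d
    by (intro lagrangian_ge[OF \<alpha>]) (auto simp: \<alpha>_def vtheta_nonneg vtheta_def[of 0])
  have ac: "abs_cont_on 0 T (\<lambda>t. pmf (\<phi> t) z)" for z
    using True by (simp add: abs_cont_path_def)
  \<comment> \<open>The coordinates are countably many, so one null set of times serves them
    all.\<close>
  have diff: "AE t in lborel. \<forall>z. t \<in> {0<..<T} \<longrightarrow> (\<lambda>s. pmf (\<phi> s) z) differentiable (at t)"
    unfolding AE_all_countable using True by (simp add: abs_cont_path_def)
  have "abs_cont_on 0 T ?f"
    by (intro abs_cont_on_add abs_cont_on_sum abs_cont_on_cmult ac)
      (auto intro: abs_cont_on_lipschitz[where K = 1])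
  then have "ennreal (?f T - ?f 0) \<le> (\<integral>\<^sup>+ t\<in>{0..T}. lagrangian lam (\<phi> t) (?d t) \<partial>lborel)"
  proof (rule abs_cont_le_nn_integral[OF T, where f' = "\<lambda>t. pairing \<alpha> (?d t) - ?C"])
    show "AE t in lborel. t \<in> {0<..<T} \<longrightarrow> (?f has_real_derivative pairing \<alpha> (?d t) - ?C) (at t)
        \<and> ennreal (pairing \<alpha> (?d t) - ?C) \<le> lagrangian lam (\<phi> t) (?d t)"
      using diff
    proof eventually_elim
      case (elim t)
      show ?case
      proof (intro impI conjI lag)
        assume "t \<in> {0<..<T}"
        then have d: "((\<lambda>s. pmf (\<phi> s) z) has_real_derivative ?d t z) (at t)" for z
          using elim by (simp add: DERIV_deriv_iff_real_differentiable)
        have "(?f has_real_derivative (\<Sum>z<n. vtheta z * ?d t z) + (- ?C) * 1) (at t)"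
          by (intro DERIV_add DERIV_sum DERIV_cmult d DERIV_ident)
        then show "(?f has_real_derivative pairing \<alpha> (?d t) - ?C) (at t)"
          by (simp add: pair)
      qed
    qed
  qed
  then have A: "ennreal (?f T - ?f 0) \<le> action lam T \<phi> \<nu>"
    using True by (simp add: action_def)
  have m0: "ennreal (?m 0) \<le> vtheta_moment \<nu>"
    unfolding vtheta_moment_eq_SUP using True by (auto intro: SUP_upper)
  have nn: "0 \<le> ?m 0" by (simp add: sum_nonneg vtheta_nonneg)
  have "ennreal (?m T) \<le> ennreal (?m T - (?m 0 + ?C * T)) + ennreal (?m 0 + ?C * T)"
    using nn C T by (intro ennreal_le_diff_plus) auto
  also have "?m T - (?m 0 + ?C * T) = ?f T - ?f 0" by simp
  also have "ennreal (?m 0 + ?C * T) = ennreal (?m 0) + ennreal (?C * T)"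
    using nn C T by (intro ennreal_plus) auto
  also have "ennreal (?f T - ?f 0) + (ennreal (?m 0) + ennreal (?C * T))
      \<le> action lam T \<phi> \<nu> + (vtheta_moment \<nu> + ennreal (?C * T))"
    by (intro add_mono A m0 order_refl)
  finally show ?thesis by (simp add: ac_simps)
qed

lemma vtheta_moment_le_action:
  assumes "0 \<le> T"
  shows "vtheta_moment (\<phi> T) \<le> vtheta_moment \<nu> + action lam T \<phi> \<nu> + ennreal (exp 1 * lam_up * T)"
  unfolding vtheta_moment_eq_SUP[of "\<phi> T"]
  by (rule SUP_least) (rule truncated_moment_le_action[OF assms])

lemma quasipotential_finite_imp_KK:
  assumes "vtheta_moment \<nu> < \<infinity>" "quasipotential lam \<nu> \<xi> < \<infinity>"
  shows "\<xi> \<in> KK"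
proof -
  obtain T \<phi> where T: "T > 0" "\<phi> T = \<xi>" "action lam T \<phi> \<nu> < \<infinity>"
    using assms(2) unfolding quasipotential_def Inf_less_iff by blast
  have "vtheta_moment \<xi> < \<infinity>"
  proof (rule le_less_trans)
    show "vtheta_moment \<xi> \<le> vtheta_moment \<nu> + action lam T \<phi> \<nu> + ennreal (exp 1 * lam_up * T)"
      using vtheta_moment_le_action[of T \<phi> \<nu>] T by simp
    show "\<dots> < \<infinity>" using assms(1) T(3) by (simp add: less_top[symmetric])
  qed
  then obtain m where m: "0 \<le> m" "vtheta_moment \<xi> = ennreal m"
    by (cases "vtheta_moment \<xi>") auto
  \<comment> \<open>\<open>KK\<close> is a union over levels from 1 upwards, hence the maximum with
    1.\<close>
  then have "\<xi> \<in> KM (max 1 m)" by (auto simp: KM_def intro: ennreal_leI)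
  then show ?thesis by (auto simp: KK_def intro!: bexI[of _ "max 1 m"])
qed

end

section \<open>The action of a mixture of paths\<close>

lemma tv_dist_le:
  assumes "\<And>A. \<bar>measure_pmf.prob p A - measure_pmf.prob q A\<bar> \<le> c"
  shows "tv_dist p q \<le> c"
  unfolding tv_dist_def using assms by (intro cSUP_least) auto

lemma tv_dist_nonneg: "0 \<le> tv_dist p q"
proof -
  have "bdd_above (range (\<lambda>A. \<bar>measure_pmf.prob p A - measure_pmf.prob q A\<bar>))"
  proof (intro bdd_aboveI2[where M = 1])
    fix A
    show "\<bar>measure_pmf.prob p A - measure_pmf.prob q A\<bar> \<le> 1"
      using measure_pmf.prob_le_1[of p A] measure_pmf.prob_le_1[of q A]
        measure_nonneg[of p A] measure_nonneg[of q A] by linarith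
  qed
  then show ?thesis
    unfolding tv_dist_def by (rule cSUP_upper2[where x = "{}"]) auto
qed

text \<open>The coordinate differences on \<open>S\<close> count twice: once for the part of
  \<open>A\<close> inside \<open>S\<close>, and once because the mass of \<open>p\<close> outside
  \<open>S\<close> exceeds that of \<open>q\<close> by at most their sum.\<close>

lemma abs_prob_diff_le:
  fixes p q :: "'a pmf"
  assumes "finite S"
  shows "\<bar>measure_pmf.prob p A - measure_pmf.prob q A\<bar>
    \<le> 2 * (\<Sum>z\<in>S. \<bar>pmf p z - pmf q z\<bar>) + (1 - measure_pmf.prob q S)"
proof -
  let ?D = "\<Sum>z\<in>S. \<bar>pmf p z - pmf q z\<bar>"
  have sub: "\<bar>measure_pmf.prob p R - measure_pmf.prob q R\<bar> \<le> ?D" if "R \<subseteq> S" for R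
  proof -
    have "\<bar>measure_pmf.prob p R - measure_pmf.prob q R\<bar> \<le> (\<Sum>z\<in>R. \<bar>pmf p z - pmf q z\<bar>)"
      using finite_subset[OF that assms]
      by (simp add: measure_measure_pmf_finite sum_subtractf[symmetric])
    also have "\<dots> \<le> ?D" using assms that by (intro sum_mono2) auto
    finally show ?thesis .
  qed
  have split: "measure_pmf.prob r A = measure_pmf.prob r (A \<inter> S) + measure_pmf.prob r (A - S)" for r :: "'a pmf"
    by (subst measure_pmf.finite_measure_Union[symmetric]) (auto simp: Int_Diff_Un)
  have tail: "measure_pmf.prob r (A - S) \<le> 1 - measure_pmf.prob r S" for r :: "'a pmf"
  proof -
    have "measure_pmf.prob r (A - S) \<le> measure_pmf.prob r (- S)"
      by (intro measure_pmf.finite_measure_mono) auto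
    also have "\<dots> = 1 - measure_pmf.prob r S"
      using measure_pmf.prob_compl[of S r] by (simp add: Compl_eq_Diff_UNIV)
    finally show ?thesis .
  qed
  show ?thesis
    using sub[OF Int_lower2[of A S]] sub[OF order_refl] split[of p] split[of q] tail[of p] tail[of q]
      measure_nonneg[of p "A - S"] measure_nonneg[of q "A - S"] by linarith
qed

text \<open>Scheffe's lemma: coordinatewise convergence to a probability measure leaves no mass to
  escape, so it is convergence in total variation.\<close>

lemma tendsto_tv_dist:
  fixes p :: "'b \<Rightarrow> nat pmf"
  assumes "\<And>z. ((\<lambda>s. pmf (p s) z) \<longlongrightarrow> pmf q z) F"
  shows "((\<lambda>s. tv_dist (p s) q) \<longlongrightarrow> 0) F"
proof (rule tendstoI)
  fix e :: real assume "e > 0"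
  have "(\<lambda>n. measure_pmf.prob q {..<n}) \<longlonglongrightarrow> measure_pmf.prob q (\<Union>n. {..<n})"
    by (intro measure_pmf.finite_Lim_measure_incseq) (auto simp: incseq_def)
  moreover have "(\<Union>n. {..<n}) = (UNIV :: nat set)" by auto
  ultimately have "(\<lambda>n. measure_pmf.prob q {..<n}) \<longlonglongrightarrow> 1" by simp
  \<comment> \<open>The tail and the finite sum are each below \<open>e / 4\<close>; the finite sum
    enters twice, which gives \<open>3 * e / 4\<close> in total.\<close>
  then have "\<forall>\<^sub>F n in sequentially. 1 - e / 4 < measure_pmf.prob q {..<n}"
    using \<open>e > 0\<close> by (intro order_tendstoD(1)) auto
  then obtain n where n: "1 - e / 4 < measure_pmf.prob q {..<n}"
    by (auto simp: eventually_sequentially)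
  have "((\<lambda>s. \<Sum>z<n. \<bar>pmf (p s) z - pmf q z\<bar>) \<longlongrightarrow> (\<Sum>z<n. \<bar>pmf q z - pmf q z\<bar>)) F"
    by (intro tendsto_intros assms)
  then have "\<forall>\<^sub>F s in F. (\<Sum>z<n. \<bar>pmf (p s) z - pmf q z\<bar>) < e / 4"
    using \<open>e > 0\<close> by (intro order_tendstoD(2)) auto
  then show "\<forall>\<^sub>F s in F. dist (tv_dist (p s) q) 0 < e"
  proof eventually_elim
    case (elim s)
    have "tv_dist (p s) q \<le> 2 * (\<Sum>z<n. \<bar>pmf (p s) z - pmf q z\<bar>) + (1 - measure_pmf.prob q {..<n})"
      by (intro tv_dist_le abs_prob_diff_le) simp
    then show ?case
      using elim n \<open>e > 0\<close> tv_dist_nonneg[of "p s" q] by (simp add: dist_real_def)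
  qed
qed

section \<open>Expectation and differentiation under a mixture\<close>

lemma expectation_bind_pmf_bounded:
  fixes G :: "'b \<Rightarrow> real"
  assumes "\<And>z. 0 \<le> G z" "\<And>z. G z \<le> B"
  shows "measure_pmf.expectation (bind_pmf p f) G
    = measure_pmf.expectation p (\<lambda>x. measure_pmf.expectation (f x) G)"
    and "integrable (measure_pmf p) (\<lambda>x. measure_pmf.expectation (f x) G)"
proof -
  have int: "integrable (measure_pmf r) G" for r :: "'b pmf"
    using assms by (intro measure_pmf.integrable_const_bound[where B = B]) auto
  have bound: "0 \<le> measure_pmf.expectation r G" "measure_pmf.expectation r G \<le> B" for r :: "'b pmf"
    using assms by (auto intro!: integral_nonneg measure_pmf.integral_le_const[OF int])
  show int2: "integrable (measure_pmf p) (\<lambda>x. measure_pmf.expectation (f x) G)"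
    using bound by (intro measure_pmf.integrable_const_bound[where B = B]) auto
  have nn: "(\<integral>\<^sup>+ z. ennreal (G z) \<partial>measure_pmf r) = ennreal (measure_pmf.expectation r G)" for r :: "'b pmf"
    using assms by (intro nn_integral_eq_integral int) auto
  have "ennreal (measure_pmf.expectation (bind_pmf p f) G)
      = (\<integral>\<^sup>+ x. \<integral>\<^sup>+ z. ennreal (G z) \<partial>measure_pmf (f x) \<partial>measure_pmf p)"
    by (simp add: nn[symmetric] nn_integral_bind_pmf)
  also have "\<dots> = ennreal (measure_pmf.expectation p (\<lambda>x. measure_pmf.expectation (f x) G))"
    unfolding nn using bound by (intro nn_integral_eq_integral int2) auto
  finally show "measure_pmf.expectation (bind_pmf p f) G
    = measure_pmf.expectation p (\<lambda>x. measure_pmf.expectation (f x) G)"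
    using bound by (subst (asm) ennreal_inj) (auto intro!: integral_nonneg)
qed

text \<open>The difference quotients at \<open>t\<close> are dominated by the integrable Lipschitz
  constants \<open>K\<close>. Dominated convergence works along sequences, so the limit is tested
  along arbitrary null sequences.\<close>

lemma has_real_derivative_expectation:
  fixes f :: "'x \<Rightarrow> real \<Rightarrow> real"
  assumes K: "integrable (measure_pmf P) K"
    and int: "\<And>s. integrable (measure_pmf P) (\<lambda>x. f x s)"
    and lip: "\<And>x s. \<bar>f x s - f x t\<bar> \<le> K x * \<bar>s - t\<bar>"
    and der: "\<And>x. (f x has_real_derivative d x) (at t)"
  shows "integrable (measure_pmf P) d"
    and "((\<lambda>s. measure_pmf.expectation P (\<lambda>x. f x s)) has_real_derivative measure_pmf.expectation P d) (at t)"
proof -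
  have quot: "integrable (measure_pmf P) d
      \<and> (\<lambda>i. measure_pmf.expectation P (\<lambda>x. (f x (t + X i) - f x t) / X i)) \<longlonglongrightarrow> measure_pmf.expectation P d"
    if X: "\<And>i. X i \<noteq> 0" "X \<longlonglongrightarrow> 0" for X :: "nat \<Rightarrow> real"
  proof -
    have lim: "AE x in measure_pmf P. (\<lambda>i. (f x (t + X i) - f x t) / X i) \<longlonglongrightarrow> d x"
    proof (rule AE_I2)
      fix x
      have "((\<lambda>h. (f x (t + h) - f x t) / h) \<longlongrightarrow> d x) (at 0)"
        using der[of x] by (simp add: DERIV_def)
      then show "(\<lambda>i. (f x (t + X i) - f x t) / X i) \<longlonglongrightarrow> d x"
        using X by (auto simp: tendsto_at_iff_sequentially o_def)
    qed
    have bound: "AE x in measure_pmf P. norm ((f x (t + X i) - f x t) / X i) \<le> K x" for i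
    proof (rule AE_I2)
      fix x
      show "norm ((f x (t + X i) - f x t) / X i) \<le> K x"
        using lip[of x "t + X i"] X(1)[of i] by (simp add: abs_divide divide_le_eq)
    qed
    show ?thesis
      using integrable_dominated_convergence[OF _ _ K lim bound]
        integral_dominated_convergence[OF _ _ K lim bound] by simp
  qed
  have "(\<lambda>i. inverse (real (Suc i))) \<longlonglongrightarrow> 0" by (rule LIMSEQ_inverse_real_of_nat)
  then show "integrable (measure_pmf P) d"
    using quot[of "\<lambda>i. inverse (real (Suc i))"] by simp
  show "((\<lambda>s. measure_pmf.expectation P (\<lambda>x. f x s)) has_real_derivative measure_pmf.expectation P d) (at t)"
    unfolding DERIV_def tendsto_at_iff_sequentially
  proof (intro allI impI)
    fix X :: "nat \<Rightarrow> real"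
    assume "\<forall>i. X i \<in> UNIV - {0}" "X \<longlonglongrightarrow> 0"
    then show "((\<lambda>h. (measure_pmf.expectation P (\<lambda>x. f x (t + h)) - measure_pmf.expectation P (\<lambda>x. f x t)) / h) \<circ> X)
      \<longlonglongrightarrow> measure_pmf.expectation P d"
      using quot[of X] int by (simp add: o_def)
  qed
qed

context jump_rates
begin

text \<open>Lower rates that do not depend on the measure. The value \<open>lam_lo\<close> for every
  other pair makes positivity hold without a side condition.\<close>

definition rate_lo :: "nat \<Rightarrow> nat \<Rightarrow> real" where
  "rate_lo z w = (if w = Suc z then lam_lo / (real z + 1) else lam_lo)"

lemma rate_lo: "(z, w) \<in> edges \<Longrightarrow> rate_lo z w \<le> lam z w \<xi>" "0 < rate_lo z w"
  using rate_up(1) rate_zero(1) lam_lo_pos by (auto simp: rate_lo_def edges_def)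

lemma exp_edge_sum_bounded:
  assumes "\<alpha> \<in> C0"
  shows "\<exists>B. \<forall>z. edge_sum (\<lambda>z w. exp (\<alpha> w - \<alpha> z) * rate_lo z w) z \<le> B"
proof -
  from C0_bounded[OF assms] obtain b where b: "\<forall>z. \<bar>\<alpha> z\<bar> \<le> b" by (elim exE)
  have "\<bar>edge_sum (\<lambda>z w. exp (\<alpha> w - \<alpha> z) * rate_lo z w) z\<bar> \<le> 2 * (exp (2 * b) * lam_lo)" for z
  proof (rule abs_edge_sum_le)
    fix w
    have "\<alpha> w - \<alpha> z \<le> 2 * b" using b[rule_format, of z] b[rule_format, of w] by linarith
    moreover have "rate_lo z w \<le> lam_lo"
      using lam_lo_pos by (auto simp: rate_lo_def divide_le_eq algebra_simps)
    ultimately show "\<bar>exp (\<alpha> w - \<alpha> z) * rate_lo z w\<bar> \<le> exp (2 * b) * lam_lo"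
      using rate_lo(2)[of z w] by (auto simp: abs_mult intro!: mult_mono)
  qed
  then show ?thesis by (intro exI allI) (rule order_trans[OF abs_ge_self])
qed

lemma exp_edge_sum_nonneg: "0 \<le> edge_sum (\<lambda>z w. exp (\<alpha> w - \<alpha> z) * rate_lo z w) z"
proof -
  have "0 \<le> exp (\<alpha> w - \<alpha> z) * rate_lo z w" for w
    using rate_lo(2)[of z w] by simp
  then show ?thesis by (simp add: edge_sum)
qed

text \<open>On each edge \<open>(exp u - 1) * lam\<close> is at least
  \<open>exp u * rate_lo - lam_up\<close>. At most two edges leave a site, hence
  \<open>2 * lam_up\<close>. The remaining bound to be proved is linear in \<open>\<xi>\<close> and
  \<open>d\<close> jointly.\<close>

lemma lagrangian_le:
  assumes "\<And>\<alpha>. \<alpha> \<in> C0 \<Longrightarrow>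
    pairing \<alpha> d - measure_pmf.expectation \<xi> (edge_sum (\<lambda>z w. exp (\<alpha> w - \<alpha> z) * rate_lo z w)) \<le> c"
  shows "lagrangian lam \<xi> d \<le> ennreal (2 * lam_up + c)"
  unfolding lagrangian_def
proof (intro SUP_least ennreal_leI)
  fix \<alpha> assume \<alpha>: "\<alpha> \<in> C0"
  let ?G = "edge_sum (\<lambda>z w. exp (\<alpha> w - \<alpha> z) * rate_lo z w)"
  let ?H = "edge_sum (\<lambda>z w. (exp (\<alpha> w - \<alpha> z) - 1) * lam z w \<xi>)"
  have le: "?G z - 2 * lam_up \<le> ?H z" for z
  proof -
    have e: "exp (\<alpha> w - \<alpha> z) * rate_lo z w - lam_up \<le> (exp (\<alpha> w - \<alpha> z) - 1) * lam z w \<xi>"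
      if "(z, w) \<in> edges" for w
    proof -
      have "exp (\<alpha> w - \<alpha> z) * rate_lo z w \<le> exp (\<alpha> w - \<alpha> z) * lam z w \<xi>"
        using rate_lo(1)[OF that] by (intro mult_left_mono) auto
      then show ?thesis unfolding left_diff_distrib using rate_le[OF that, of \<xi>] by linarith
    qed
    show ?thesis
      using e[of "Suc z"] e[of 0] lam_up_pos by (cases "z = 0") (auto simp: edge_sum edges_def)
  qed
  from exp_edge_sum_bounded[OF \<alpha>] obtain B where B: "\<forall>z. ?G z \<le> B" by (elim exE)
  have intG: "integrable (measure_pmf \<xi>) ?G"
    using B exp_edge_sum_nonneg by (intro measure_pmf.integrable_const_bound[where B = B]) auto
  have "measure_pmf.expectation \<xi> ?G - 2 * lam_up = measure_pmf.expectation \<xi> (\<lambda>z. ?G z - 2 * lam_up)"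
    using intG by simp
  also have "\<dots> \<le> measure_pmf.expectation \<xi> ?H"
    using intG by (intro integral_mono integrable_exp_edge_sum[OF \<alpha>] le) auto
  finally show "pairing \<alpha> (\<lambda>z. d z - mv_field lam \<xi> z)
        - (\<Sum>\<^sub>\<infinity>(z, z')\<in>edges. tau (\<alpha> z' - \<alpha> z) * lam z z' \<xi> * pmf \<xi> z) \<le> 2 * lam_up + c"
    unfolding lagrangian_bracket[OF \<alpha>] using assms[OF \<alpha>] by linarith
qed

text \<open>For fixed \<open>\<alpha>\<close> the reduced bracket of the mixture is the mean of the
  brackets of its components. Each is bounded by \<open>B x\<close> uniformly in
  \<open>\<alpha>\<close> and in time, so the mean of \<open>B\<close> bounds the supremum. The
  countable set \<open>D\<close> of exceptional times must be common to all components.\<close>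

lemma mixture_action_le:
  fixes P :: "'x pmf" and \<psi> :: "'x \<Rightarrow> real \<Rightarrow> nat pmf" and d\<psi> :: "'x \<Rightarrow> real \<Rightarrow> nat \<Rightarrow> real"
  assumes T: "0 < T"
    and K: "integrable (measure_pmf P) K" and B: "integrable (measure_pmf P) B"
    and lip: "\<And>x z s t. \<bar>pmf (\<psi> x s) z - pmf (\<psi> x t) z\<bar> \<le> K x * \<bar>s - t\<bar>"
    and D: "countable D"
    and der: "\<And>x z t. \<lbrakk>0 < t; t < T; t \<notin> D\<rbrakk> \<Longrightarrow> ((\<lambda>s. pmf (\<psi> x s) z) has_real_derivative d\<psi> x t z) (at t)"
    and bound: "\<And>x \<alpha> t. \<lbrakk>0 < t; t < T; t \<notin> D; \<alpha> \<in> C0\<rbrakk> \<Longrightarrow>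
      pairing \<alpha> (d\<psi> x t) - measure_pmf.expectation (\<psi> x t) (edge_sum (\<lambda>z w. exp (\<alpha> w - \<alpha> z) * rate_lo z w)) \<le> B x"
  defines "\<phi> \<equiv> \<lambda>t. bind_pmf P (\<lambda>x. \<psi> x t)"
  shows "cadlag_path T \<phi>"
    and "action lam T \<phi> (\<phi> 0) \<le> ennreal (2 * lam_up + measure_pmf.expectation P B) * ennreal T"
proof -
  have pmf: "pmf (\<phi> t) z = measure_pmf.expectation P (\<lambda>x. pmf (\<psi> x t) z)" for t z
    by (simp add: \<phi>_def pmf_bind)
  have int: "integrable (measure_pmf P) (\<lambda>x. pmf (\<psi> x t) z)" for t z
    by (intro measure_pmf.integrable_const_bound[where B = 1]) (auto simp: pmf_le_1)
  have \<phi>_lip: "\<bar>pmf (\<phi> s) z - pmf (\<phi> t) z\<bar> \<le> measure_pmf.expectation P K * \<bar>s - t\<bar>" for s t z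
  proof -
    have "\<bar>pmf (\<phi> s) z - pmf (\<phi> t) z\<bar> = \<bar>measure_pmf.expectation P (\<lambda>x. pmf (\<psi> x s) z - pmf (\<psi> x t) z)\<bar>"
      unfolding pmf using int by simp
    also have "\<dots> \<le> measure_pmf.expectation P (\<lambda>x. \<bar>pmf (\<psi> x s) z - pmf (\<psi> x t) z\<bar>)"
      by (rule integral_abs_bound)
    also have "\<dots> \<le> measure_pmf.expectation P (\<lambda>x. K x * \<bar>s - t\<bar>)"
      using K int by (intro integral_mono lip integrable_abs Bochner_Integration.integrable_diff) auto
    finally show ?thesis by simp
  qed
  have cont: "((\<lambda>s. pmf (\<phi> s) z) \<longlongrightarrow> pmf (\<phi> t) z) (at t within S)" for t z S
  proof (rule Lim_null_comparison[THEN Lim_null[THEN iffD2]])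
    show "\<forall>\<^sub>F s in at t within S. norm (pmf (\<phi> s) z - pmf (\<phi> t) z) \<le> measure_pmf.expectation P K * \<bar>s - t\<bar>"
      using \<phi>_lip by simp
    have "((\<lambda>s. measure_pmf.expectation P K * \<bar>s - t\<bar>) \<longlongrightarrow> measure_pmf.expectation P K * \<bar>t - t\<bar>) (at t within S)"
      by (intro tendsto_intros)
    then show "((\<lambda>s. measure_pmf.expectation P K * \<bar>s - t\<bar>) \<longlongrightarrow> 0) (at t within S)" by simp
  qed
  show "cadlag_path T \<phi>"
    unfolding cadlag_path_def using tendsto_tv_dist[OF cont] by blast
  have deriv: "integrable (measure_pmf P) (\<lambda>x. d\<psi> x t z)"
    "((\<lambda>s. pmf (\<phi> s) z) has_real_derivative measure_pmf.expectation P (\<lambda>x. d\<psi> x t z)) (at t)"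
    if "0 < t" "t < T" "t \<notin> D" for t z
    using has_real_derivative_expectation[OF K int lip der[OF that]] by (auto simp: pmf)
  have lag: "lagrangian lam (\<phi> t) (\<lambda>z. deriv (\<lambda>s. pmf (\<phi> s) z) t)
      \<le> ennreal (2 * lam_up + measure_pmf.expectation P B)" if t: "0 < t" "t < T" "t \<notin> D" for t
  proof (rule lagrangian_le)
    fix \<alpha> assume \<alpha>: "\<alpha> \<in> C0"
    let ?G = "edge_sum (\<lambda>z w. exp (\<alpha> w - \<alpha> z) * rate_lo z w)"
    from exp_edge_sum_bounded[OF \<alpha>] obtain b where b: "\<forall>z. ?G z \<le> b" by (elim exE)
    note EG = expectation_bind_pmf_bounded[OF exp_edge_sum_nonneg b[rule_format], of P "\<lambda>x. \<psi> x t"]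
    have dint: "integrable (measure_pmf P) (\<lambda>x. pairing \<alpha> (d\<psi> x t))"
      unfolding pairing_def using deriv(1)[OF t]
      by (intro Bochner_Integration.integrable_sum integrable_mult_right)
    have "pairing \<alpha> (\<lambda>z. deriv (\<lambda>s. pmf (\<phi> s) z) t)
        = (\<Sum>z\<in>{z. \<alpha> z \<noteq> 0}. \<alpha> z * measure_pmf.expectation P (\<lambda>x. d\<psi> x t z))"
      unfolding pairing_def using DERIV_imp_deriv[OF deriv(2)[OF t]] by simp
    also have "\<dots> = measure_pmf.expectation P (\<lambda>x. pairing \<alpha> (d\<psi> x t))"
      unfolding pairing_def using deriv(1)[OF t] by (subst Bochner_Integration.integral_sum) auto
    \<comment> \<open>Here the affinity is used: both terms are means over \<open>P\<close> of the
      corresponding terms of a single component.\<close>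
    finally have "pairing \<alpha> (\<lambda>z. deriv (\<lambda>s. pmf (\<phi> s) z) t) - measure_pmf.expectation (\<phi> t) ?G
        = measure_pmf.expectation P (\<lambda>x. pairing \<alpha> (d\<psi> x t) - measure_pmf.expectation (\<psi> x t) ?G)"
      unfolding \<phi>_def EG(1) using dint EG(2) by simp
    also have "\<dots> \<le> measure_pmf.expectation P B"
      using dint EG(2) B by (intro integral_mono bound t \<alpha> Bochner_Integration.integrable_diff) auto
    finally show "pairing \<alpha> (\<lambda>z. deriv (\<lambda>s. pmf (\<phi> s) z) t) - measure_pmf.expectation (\<phi> t) ?G
        \<le> measure_pmf.expectation P B" .
  qed
  have AE: "AE t in lborel. t \<notin> D \<union> {0, T}"
    by (intro AE_not_in countable_imp_null_set_lborel) (simp add: D)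
  have "abs_cont_path T \<phi>"
    unfolding abs_cont_path_def
  proof (intro allI conjI)
    fix z
    show "abs_cont_on 0 T (\<lambda>t. pmf (\<phi> t) z)"
    proof (rule abs_cont_on_lipschitz)
      fix s t :: real assume "s \<le> t"
      then show "\<bar>pmf (\<phi> t) z - pmf (\<phi> s) z\<bar> \<le> measure_pmf.expectation P K * (t - s)"
        using \<phi>_lip[of t z s] by simp
    qed
    show "AE t in lborel. t \<in> {0<..<T} \<longrightarrow> (\<lambda>s. pmf (\<phi> s) z) differentiable (at t)"
      using AE
    proof eventually_elim
      case (elim t)
      then show ?case using deriv(2)[of t z] by (auto simp: real_differentiable_def)
    qed
  qed
  then have "action lam T \<phi> (\<phi> 0)
      = (\<integral>\<^sup>+ t\<in>{0..T}. lagrangian lam (\<phi> t) (\<lambda>z. deriv (\<lambda>s. pmf (\<phi> s) z) t) \<partial>lborel)"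
    by (simp add: action_def)
  also have "\<dots> \<le> (\<integral>\<^sup>+ t. ennreal (2 * lam_up + measure_pmf.expectation P B) * indicator {0..T} t \<partial>lborel)"
    by (rule nn_integral_mono_AE, use AE in eventually_elim) (auto simp: indicator_def lag)
  also have "\<dots> = ennreal (2 * lam_up + measure_pmf.expectation P B) * ennreal T"
    using T by (simp add: nn_integral_cmult_indicator)
  finally show "action lam T \<phi> (\<phi> 0) \<le> ennreal (2 * lam_up + measure_pmf.expectation P B) * ennreal T" .
qed

end

section \<open>The path of a single particle\<close>

text \<open>The case \<open>i = j\<close> is allowed; it occurs for a particle starting at 0 during
  its first stage.\<close>

definition two_point :: "real \<Rightarrow> nat \<Rightarrow> nat \<Rightarrow> nat pmf" where
  "two_point q i j = bind_pmf (bernoulli_pmf q) (\<lambda>b. return_pmf (if b then i else j))"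

lemma pmf_two_point:
  assumes "0 \<le> q" "q \<le> 1"
  shows "pmf (two_point q i j) z = q * of_bool (i = z) + (1 - q) * of_bool (j = z)"
  using assms by (simp add: two_point_def pmf_bind indicator_def)

lemma two_point_1: "two_point 1 i j = return_pmf i"
  by (rule pmf_eqI) (simp add: pmf_two_point indicator_def)

lemma expectation_two_point_ge:
  fixes G :: "nat \<Rightarrow> real"
  assumes "0 \<le> q" "q \<le> 1" "\<And>z. 0 \<le> G z"
  shows "q * G i \<le> measure_pmf.expectation (two_point q i j) G"
proof -
  have "two_point q i j = map_pmf (\<lambda>b. if b then i else j) (bernoulli_pmf q)"
    by (simp add: two_point_def map_pmf_def)
  then show ?thesis using assms by (simp add: mult.commute)
qed

definition clip :: "real \<Rightarrow> real" where
  "clip u = min 1 (max 0 u)"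

lemma clip_lipschitz: "\<bar>clip u - clip v\<bar> \<le> \<bar>u - v\<bar>"
  unfolding clip_def by linarith

lemma clip_bounds: "0 \<le> clip u" "clip u \<le> 1"
  by (simp_all add: clip_def)

lemma clip_eq: "u \<le> 0 \<Longrightarrow> clip u = 0" "0 \<le> u \<Longrightarrow> u \<le> 1 \<Longrightarrow> clip u = u" "1 \<le> u \<Longrightarrow> clip u = 1"
  by (simp_all add: clip_def)

text \<open>The mass profile of a site around its visit at \<open>u = 0\<close>: it fills as
  \<open>1 - u\<^sup>2\<close> on [-1, 0], empties as \<open>(1 - u)\<^sup>2\<close> on [0, 1] and
  vanishes elsewhere. Clipping gives one globally Lipschitz formula.\<close>

definition tent :: "real \<Rightarrow> real" where
  "tent u = (1 - clip u)\<^sup>2 - (clip (- u))\<^sup>2"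

lemma tent_lipschitz: "\<bar>tent u - tent v\<bar> \<le> 4 * \<bar>u - v\<bar>"
proof -
  have sq: "\<bar>p\<^sup>2 - q\<^sup>2\<bar> \<le> 2 * \<bar>p - q\<bar>" if "0 \<le> p" "p \<le> 1" "0 \<le> q" "q \<le> 1" for p q :: real
  proof -
    have "\<bar>p\<^sup>2 - q\<^sup>2\<bar> = \<bar>p + q\<bar> * \<bar>p - q\<bar>"
      by (simp only: power2_eq_square square_diff_square_factored abs_mult)
    also have "\<dots> \<le> 2 * \<bar>p - q\<bar>" using that by (intro mult_right_mono) auto
    finally show ?thesis .
  qed
  have "\<bar>(1 - clip u)\<^sup>2 - (1 - clip v)\<^sup>2\<bar> \<le> 2 * \<bar>(1 - clip u) - (1 - clip v)\<bar>"
    by (rule sq) (simp_all add: clip_bounds)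
  also have "\<dots> \<le> 2 * \<bar>u - v\<bar>"
    using clip_lipschitz[of v u] by (simp add: abs_minus_commute)
  finally have A: "\<bar>(1 - clip u)\<^sup>2 - (1 - clip v)\<^sup>2\<bar> \<le> 2 * \<bar>u - v\<bar>" .
  have "\<bar>(clip (- v))\<^sup>2 - (clip (- u))\<^sup>2\<bar> \<le> 2 * \<bar>clip (- v) - clip (- u)\<bar>"
    by (rule sq) (simp_all add: clip_bounds)
  also have "\<dots> \<le> 2 * \<bar>u - v\<bar>"
    using clip_lipschitz[of "- v" "- u"] by simp
  finally have B: "\<bar>(clip (- v))\<^sup>2 - (clip (- u))\<^sup>2\<bar> \<le> 2 * \<bar>u - v\<bar>" .
  have "tent u - tent v = ((1 - clip u)\<^sup>2 - (1 - clip v)\<^sup>2) + ((clip (- v))\<^sup>2 - (clip (- u))\<^sup>2)"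
    by (simp add: tent_def)
  then show ?thesis using abs_triangle_ineq[of "(1 - clip u)\<^sup>2 - (1 - clip v)\<^sup>2" "(clip (- v))\<^sup>2 - (clip (- u))\<^sup>2"] A B
    by simp
qed

lemma tent_eq:
  "\<bar>u\<bar> \<ge> 1 \<Longrightarrow> tent u = 0"
  "0 \<le> u \<Longrightarrow> u \<le> 1 \<Longrightarrow> tent u = (1 - u)\<^sup>2"
  "-1 \<le> u \<Longrightarrow> u \<le> 0 \<Longrightarrow> tent u = 1 - u\<^sup>2"
  by (cases "0 \<le> u") (simp_all add: tent_def clip_eq)

text \<open>A particle starts at \<open>a\<close>, visits \<open>0\<close> at clock time \<open>1\<close> and then climbs one site per clock unit;
  \<open>site a m\<close> is its position at the integer clock time \<open>m\<close>.\<close>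

definition site :: "nat \<Rightarrow> nat \<Rightarrow> nat" where
  "site a m = (if m = 0 then a else m - 1)"

text \<open>Speed 1 up to time 1 and speed \<open>N\<close> afterwards, so the reading at time 2 is
  \<open>N + 1\<close> for every \<open>N\<close>. All particles thus finish together, as a mixture
  requires.\<close>

definition clock :: "nat \<Rightarrow> real \<Rightarrow> real" where
  "clock N t = clip t + real N * max 0 (t - 1)"

text \<open>The quadratic weight makes the flow between consecutive sites vanish linearly while the mass
  left behind vanishes quadratically, so that the instantaneous cost stays bounded.\<close>

definition particle :: "nat \<times> nat \<Rightarrow> real \<Rightarrow> nat pmf" where
  "particle x t = (let y = clock (snd x) t in
     two_point ((1 - frac y)\<^sup>2) (site (fst x) (nat \<lfloor>y\<rfloor>)) (site (fst x) (Suc (nat \<lfloor>y\<rfloor>))))"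

lemma clock_nonneg: "0 \<le> clock N t"
  by (simp add: clock_def clip_bounds)

lemma clock_lipschitz: "\<bar>clock N s - clock N t\<bar> \<le> (real N + 1) * \<bar>s - t\<bar>"
proof -
   have "\<bar>real N * max 0 (s - 1) - real N * max 0 (t - 1)\<bar> \<le> real N * \<bar>s - t\<bar>"
    unfolding right_diff_distrib[symmetric] abs_mult by (intro mult_mono) auto
  then have "\<bar>clip s - clip t\<bar> + \<bar>real N * max 0 (s - 1) - real N * max 0 (t - 1)\<bar> \<le> (real N + 1) * \<bar>s - t\<bar>"
    unfolding distrib_right using clip_lipschitz[of s t] by simp
  then show ?thesis
    unfolding clock_def by (rule order_trans[OF abs_diff_triangle_ineq])
qed

lemma frac_weight: "0 \<le> (1 - frac y)\<^sup>2" "(1 - frac y)\<^sup>2 \<le> (1::real)"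
  using frac_ge_0[of y] frac_lt_1[of y] by (auto intro!: power_le_one)

text \<open>Replaces the description by floor and fractional part, which switches formula at integer
  readings, by Lipschitz functions of the clock. The first term is the emptying of the starting
  site, the second the visit to \<open>z\<close> at reading \<open>z + 1\<close>.\<close>

lemma pmf_particle:
  "pmf (particle x t) z
    = of_bool (fst x = z) * tent (clock (snd x) t) + tent (clock (snd x) t - (real z + 1))"
proof -
  define y where "y = clock (snd x) t"
  define m where "m = nat \<lfloor>y\<rfloor>"
  define s where "s = frac y"
  have "0 \<le> \<lfloor>y\<rfloor>" using clock_nonneg by (simp add: y_def)
  then have y: "y = real m + s" by (simp add: m_def s_def frac_def)
  have s: "0 \<le> s" "s < 1" by (auto simp: s_def frac_lt_1)
  have "pmf (particle x t) z = (1 - s)\<^sup>2 * of_bool (site (fst x) m = z) + (1 - (1 - s)\<^sup>2) * of_bool (m = z)"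
    unfolding particle_def Let_def y_def[symmetric] m_def[symmetric] s_def[symmetric]
    by (subst pmf_two_point) (auto simp: s_def frac_weight site_def)
  moreover have "tent y = (if m = 0 then (1 - s)\<^sup>2 else 0)"
    using s by (simp add: tent_eq y)
  moreover have "tent (y - (real z + 1)) = (if m = Suc z then (1 - s)\<^sup>2 else if m = z then 1 - (1 - s)\<^sup>2 else 0)"
  proof -
    consider "m = Suc z" | "m = z" | "m < z" | "Suc z < m" by linarith
    then show ?thesis
    proof cases
      case 1
      then show ?thesis using s by (simp add: tent_eq y)
    next
      case 2
      then have "y - (real z + 1) = s - 1" by (simp add: y)
      then have "tent (y - (real z + 1)) = 1 - (s - 1)\<^sup>2"
        using s by (simp only:) (intro tent_eq, auto)
      then show ?thesis using 2 by (simp add: power2_commute)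
    next
      case 3
      then have "real m + 1 \<le> real z" by linarith
      then have "y - (real z + 1) \<le> -1" using s by (simp add: y)
      then show ?thesis using 3 by (simp add: tent_eq)
    next
      case 4
      then have "real z + 2 \<le> real m" by linarith
      then have "1 \<le> y - (real z + 1)" using s by (simp add: y)
      then show ?thesis using 4 by (simp add: tent_eq)
    qed
  qed
  ultimately show ?thesis unfolding y_def[symmetric] by (auto simp: site_def)
qed

lemma pmf_particle_lipschitz:
  "\<bar>pmf (particle x s) z - pmf (particle x t) z\<bar> \<le> 8 * (real (snd x) + 1) * \<bar>s - t\<bar>"
proof -
  let ?c = "\<lambda>t. clock (snd x) t"
  have "\<bar>tent (?c s) - tent (?c t)\<bar> \<le> 4 * \<bar>?c s - ?c t\<bar>" by (rule tent_lipschitz)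
  moreover have "\<bar>tent (?c s - (real z + 1)) - tent (?c t - (real z + 1))\<bar> \<le> 4 * \<bar>?c s - ?c t\<bar>"
    using tent_lipschitz[of "?c s - (real z + 1)" "?c t - (real z + 1)"] by simp
  moreover have "\<bar>?c s - ?c t\<bar> \<le> (real (snd x) + 1) * \<bar>s - t\<bar>" by (rule clock_lipschitz)
  moreover have "\<bar>pmf (particle x s) z - pmf (particle x t) z\<bar>
      \<le> \<bar>tent (?c s) - tent (?c t)\<bar> + \<bar>tent (?c s - (real z + 1)) - tent (?c t - (real z + 1))\<bar>"
  proof -
    have "\<bar>of_bool (fst x = z) * tent (?c s) - of_bool (fst x = z) * tent (?c t)\<bar> \<le> \<bar>tent (?c s) - tent (?c t)\<bar>"
      by simp
    then show ?thesis
      unfolding pmf_particle by (intro order_trans[OF abs_diff_triangle_ineq] add_mono order_refl)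
  qed
  ultimately have "\<bar>pmf (particle x s) z - pmf (particle x t) z\<bar> \<le> 8 * ((real (snd x) + 1) * \<bar>s - t\<bar>)"
    by linarith
  then show ?thesis by (simp only: mult.assoc)
qed

text \<open>The speed of the clock away from \<open>t = 1\<close>; the value at that rational time
  is a default, as rational times are exceptional.\<close>

definition particle_rate :: "nat \<Rightarrow> real \<Rightarrow> real" where
  "particle_rate N t = (if t < 1 then 1 else real N)"

text \<open>The weight \<open>(1 - frac y)\<^sup>2\<close> of the present site decreases at rate
  \<open>2 * (1 - frac y)\<close> times the clock speed, and the same amount enters the next
  site.\<close>

definition dparticle :: "nat \<times> nat \<Rightarrow> real \<Rightarrow> nat \<Rightarrow> real" where
  "dparticle x t z = (let y = clock (snd x) t in
     2 * (1 - frac y) * particle_rate (snd x) t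
       * (of_bool (site (fst x) (Suc (nat \<lfloor>y\<rfloor>)) = z) - of_bool (site (fst x) (nat \<lfloor>y\<rfloor>) = z)))"

lemma clock_has_derivative:
  assumes "0 < t" "t \<noteq> 1"
  shows "(clock N has_real_derivative particle_rate N t) (at t)"
proof (cases "t < 1")
  case True
  have "((\<lambda>t. t) has_real_derivative particle_rate N t) (at t)"
    using True by (auto simp: particle_rate_def)
  moreover have "t \<in> {0<..<1}" using True assms by simp
  ultimately show ?thesis
    by (rule has_field_derivative_transform_within_open[OF _ open_greaterThanLessThan]) (auto simp: clock_def clip_eq)
next
  case False
  have "((\<lambda>t. 1 + real N * (t - 1)) has_real_derivative particle_rate N t) (at t)"
    using False by (auto simp: particle_rate_def intro!: derivative_eq_intros)
  moreover have "t \<in> {1<..}" using False assms by simp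
  ultimately show ?thesis
    by (rule has_field_derivative_transform_within_open[OF _ open_greaterThan]) (auto simp: clock_def clip_eq)
qed

text \<open>On each stage the clock is affine with rational coefficients and nonzero slope, so
  irrational times have irrational readings. Hence the rationals serve as exceptional times for all
  particles at once.\<close>

lemma clock_not_int:
  assumes "t \<notin> \<rat>" "0 < t" "t < 1 \<or> N \<noteq> 0"
  shows "clock N t \<notin> \<int>"
proof
  assume int: "clock N t \<in> \<int>"
  have "t \<noteq> 1" using assms(1) by auto
  have rat: "clock N t \<in> \<rat>" using int Ints_subset_Rats by blast
  show False
  proof (cases "t < 1")
    case True
    then show False using rat assms by (simp add: clock_def clip_eq)
  next
    case False
    then have N: "N \<noteq> 0" using assms(3) by simp
    have "clock N t = 1 + real N * (t - 1)" using False by (simp add: clock_def clip_eq)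
    then have "t = (clock N t - 1) / real N + 1" using N by simp
    moreover have "(clock N t - 1) / real N + 1 \<in> \<rat>" using rat by (intro Rats_add Rats_divide Rats_diff) auto
    ultimately show False using assms(1) by simp
  qed
qed

lemma particle_has_derivative:
  assumes "0 < t" "t \<notin> \<rat>"
  shows "((\<lambda>s. pmf (particle x s) z) has_real_derivative dparticle x t z) (at t)"
proof -
  define N where "N = snd x"
  have t1: "t \<noteq> 1" using assms(2) by auto
  show ?thesis
  proof (cases "t < 1 \<or> N \<noteq> 0")
    \<comment> \<open>For \<open>N = 0\<close> the clock stops at the integer reading 1, but then
      the path is constant after time 1.\<close>
    case False
    then have t: "1 < t" "N = 0" using t1 by auto
    have "((\<lambda>s. pmf (particle x t) z) has_real_derivative 0) (at t)" by simp
    moreover have "t \<in> {1<..}" using t by simp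
    moreover have "pmf (particle x t) z = pmf (particle x s) z" if "s \<in> {1<..}" for s
      using that t by (simp add: pmf_particle clock_def clip_eq N_def[symmetric])
    ultimately have "((\<lambda>s. pmf (particle x s) z) has_real_derivative 0) (at t)"
      by (rule has_field_derivative_transform_within_open[OF _ open_greaterThan])
    moreover have "dparticle x t z = 0"
      using t by (simp add: dparticle_def Let_def particle_rate_def N_def)
    ultimately show ?thesis by simp
  next
    case True
    define k where "k = \<lfloor>clock N t\<rfloor>"
    have k: "of_int k < clock N t" "clock N t < of_int k + 1"
    proof -
      have "clock N t \<noteq> of_int k" using clock_not_int[OF assms(2,1) True] by (metis Ints_of_int)
      then show "of_int k < clock N t" using of_int_floor_le[of "clock N t"] unfolding k_def by linarith
      show "clock N t < of_int k + 1" by (simp add: k_def)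
    qed
    have d: "(clock N has_real_derivative particle_rate N t) (at t)"
      by (rule clock_has_derivative[OF assms(1) t1])
    then have cont: "(clock N \<longlongrightarrow> clock N t) (nhds t)"
      using DERIV_isCont by (auto simp: isCont_def tendsto_at_iff_tendsto_nhds)
    \<comment> \<open>The reading is not an integer at \<open>t\<close>, so its floor is constant
      nearby and the weight is locally a quadratic polynomial in the clock.\<close>
    have ev: "\<forall>\<^sub>F s in nhds t. of_int k < clock N s \<and> clock N s < of_int k + 1"
      using order_tendstoD[OF cont] k by (auto intro: eventually_conj)
    let ?i = "site (fst x) (nat k)" and ?j = "site (fst x) (Suc (nat k))"
    let ?q = "\<lambda>s. (1 - (clock N s - of_int k))\<^sup>2"
    have "\<forall>\<^sub>F s in nhds t. pmf (particle x s) z = ?q s * of_bool (?i = z) + (1 - ?q s) * of_bool (?j = z)"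
      using ev
    proof eventually_elim
      case (elim s)
      have fl: "\<lfloor>clock N s\<rfloor> = k" using elim by linarith
      then have fr: "frac (clock N s) = clock N s - of_int k" by (simp add: frac_def)
      show ?case
        unfolding particle_def Let_def N_def[symmetric] fr[symmetric] fl
        by (intro pmf_two_point frac_weight)
    qed
    moreover have "((\<lambda>s. ?q s * of_bool (?i = z) + (1 - ?q s) * of_bool (?j = z)) has_real_derivative
        dparticle x t z) (at t)"
    proof -
      have fr: "frac (clock N t) = clock N t - of_int k" by (simp add: frac_def k_def)
      show ?thesis
        by (rule derivative_eq_intros d refl)+
          (simp add: dparticle_def Let_def N_def[symmetric] fr k_def[symmetric] algebra_simps)
    qed
    ultimately show ?thesis
      by (subst DERIV_cong_ev[OF refl _ refl])
  qed
qed

text \<open>Fenchel's inequality: the right-hand side is the Legendre conjugate of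
  \<open>c * exp \<Delta>\<close> at \<open>v\<close>. It is the inequality
  \<open>ln u \<le> u - 1\<close> at \<open>u = exp \<Delta> * c / v\<close>.\<close>

lemma mult_ln_bound:
  fixes v c \<Delta> :: real
  assumes "0 < v" "0 < c"
  shows "v * \<Delta> - exp \<Delta> * c \<le> v * ln (v / c) - v"
proof -
  let ?u = "exp \<Delta> * c / v"
  have "0 < ?u" using assms by simp
  then have "ln ?u \<le> ?u - 1" by (rule ln_le_minus_one)
  moreover have "ln ?u = \<Delta> - ln (v / c)" using assms by (simp add: ln_mult ln_div)
  ultimately have "v * (\<Delta> - ln (v / c)) \<le> v * (?u - 1)"
    using assms by (intro mult_left_mono) auto
  also have "v * (?u - 1) = exp \<Delta> * c - v" using assms by (simp add: right_diff_distrib)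
  finally show ?thesis by (simp add: algebra_simps)
qed

text \<open>Fenchel's inequality for the flow \<open>2 * (1 - s) * r\<close> out of a site of mass
  \<open>(1 - s)\<^sup>2\<close> and rate \<open>b\<close>. The quotient of flow by mass times rate
  blows up like \<open>1 / (1 - s)\<close>, but only its logarithm occurs, multiplied by
  \<open>1 - s\<close>.\<close>

lemma transfer_cost_bound:
  fixes r b s \<Delta> :: real
  assumes "0 < r" "0 < b" "0 \<le> s" "s < 1"
  shows "2 * (1 - s) * r * \<Delta> - (1 - s)\<^sup>2 * (exp \<Delta> * b) \<le> 2 * r * (\<bar>ln (2 * r / b)\<bar> + 1)"
proof -
  let ?w = "1 - s"
  have w: "0 < ?w" "?w \<le> 1" using assms by auto
  have "2 * ?w * r * \<Delta> - ?w\<^sup>2 * (exp \<Delta> * b) = (2 * ?w * r) * \<Delta> - exp \<Delta> * (?w\<^sup>2 * b)"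
    by (simp add: algebra_simps)
  also have "\<dots> \<le> (2 * ?w * r) * ln (2 * ?w * r / (?w\<^sup>2 * b)) - 2 * ?w * r"
    using assms w by (intro mult_ln_bound) auto
  also have "2 * ?w * r / (?w\<^sup>2 * b) = (2 * r / b) / ?w"
    using w assms(2) by (simp add: power2_eq_square divide_simps)
  also have "ln ((2 * r / b) / ?w) = ln (2 * r / b) - ln ?w"
    using assms w by (subst ln_div) auto
  also have "(2 * ?w * r) * (ln (2 * r / b) - ln ?w) - 2 * ?w * r
      = 2 * r * (?w * ln (2 * r / b) + (- ?w * ln ?w) - ?w)" by (simp add: algebra_simps)
  also have "\<dots> \<le> 2 * r * (\<bar>ln (2 * r / b)\<bar> + 1)"
  proof (intro mult_left_mono)
    have "?w * ln (2 * r / b) \<le> ?w * \<bar>ln (2 * r / b)\<bar>" using w by (intro mult_left_mono) auto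
    also have "\<dots> \<le> 1 * \<bar>ln (2 * r / b)\<bar>" using w by (intro mult_right_mono) auto
    finally have "?w * ln (2 * r / b) \<le> \<bar>ln (2 * r / b)\<bar>" by simp
    moreover have "- ?w * ln ?w \<le> 1"
    proof -
      have "- ln ?w = ln (1 / ?w)" using w by (simp add: ln_div)
      also have "\<dots> \<le> 1 / ?w - 1" using w by (intro ln_le_minus_one) simp
      finally have "?w * (- ln ?w) \<le> ?w * (1 / ?w - 1)" using w by (intro mult_left_mono) auto
      also have "\<dots> = 1 - ?w" using w by (simp add: right_diff_distrib)
      finally have "?w * (- ln ?w) \<le> 1 - ?w" .
      moreover have "- ?w * ln ?w = ?w * (- ln ?w)" by (simp only: mult_minus_left mult_minus_right)
      ultimately show ?thesis using w by linarith
    qed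
    ultimately show "?w * ln (2 * r / b) + (- ?w * ln ?w) - ?w \<le> \<bar>ln (2 * r / b)\<bar> + 1"
      using w by linarith
  qed (use assms in auto)
  finally show ?thesis .
qed

lemma pairing_of_bool_diff:
  assumes "\<alpha> \<in> C0"
  shows "pairing \<alpha> (\<lambda>z. c * (of_bool (j = z) - of_bool (i = z))) = c * (\<alpha> j - \<alpha> i)"
proof -
  have fin: "finite (insert i (insert j {z. \<alpha> z \<noteq> 0}))" (is "finite ?S") using assms by (simp add: C0_def)
  have "pairing \<alpha> (\<lambda>z. c * (of_bool (j = z) - of_bool (i = z)))
      = (\<Sum>z\<in>?S. \<alpha> z * (c * (of_bool (j = z) - of_bool (i = z))))"
    by (rule pairing_superset[OF fin]) auto
  also have "\<dots> = c * ((\<Sum>z\<in>?S. \<alpha> z * of_bool (j = z)) - (\<Sum>z\<in>?S. \<alpha> z * of_bool (i = z)))"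
    by (simp add: sum_distrib_left sum_subtractf[symmetric] algebra_simps)
  also have "(\<Sum>z\<in>?S. \<alpha> z * of_bool (j = z)) = \<alpha> j"
    using fin by (subst sum.remove[of _ j]) (auto intro!: sum.neutral)
  also have "(\<Sum>z\<in>?S. \<alpha> z * of_bool (i = z)) = \<alpha> i"
    using fin by (subst sum.remove[of _ i]) (auto intro!: sum.neutral)
  finally show ?thesis .
qed

lemma KM_vtheta:
  assumes "p \<in> KM M" "0 \<le> M"
  shows "integrable (measure_pmf p) vtheta" "measure_pmf.expectation p vtheta \<le> M"
proof -
  have m: "(\<integral>\<^sup>+ z. ennreal (vtheta z) \<partial>measure_pmf p) \<le> ennreal M"
    using assms by (simp add: KM_def vtheta_moment_def)
  then have "(\<integral>\<^sup>+ z. ennreal (vtheta z) \<partial>measure_pmf p) < \<infinity>"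
    using ennreal_less_top[of M] by (auto intro: le_less_trans)
  then show int: "integrable (measure_pmf p) vtheta"
    by (intro integrableI_nonneg) (auto simp: vtheta_nonneg)
  have "ennreal (measure_pmf.expectation p vtheta) \<le> ennreal M"
    using m by (subst (asm) nn_integral_eq_integral[OF int]) (auto simp: vtheta_nonneg)
  then show "measure_pmf.expectation p vtheta \<le> M" using assms(2) by simp
qed

text \<open>Controls first moments by \<open>\<vartheta>\<close>: beyond 3, which exceeds e, the
  logarithm is at least 1.\<close>

lemma le_vtheta: "real n \<le> 3 + vtheta n"
proof (cases "n \<le> 3")
  case True
  then show ?thesis using vtheta_nonneg[of n] by linarith
next
  case False
  have "exp 1 \<le> (3::real)" by (rule exp_le)
  also have "3 \<le> real n" using False by simp
  finally have "1 \<le> ln (real n)" using False by (subst ln_ge_iff) auto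
  then have "real n * 1 \<le> real n * ln (real n)" by (intro mult_left_mono) auto
  then show ?thesis by (simp add: vtheta_def)
qed

section \<open>Cost of one particle and of the mixture\<close>

context jump_rates
begin

text \<open>\<open>4 * vtheta N\<close> comes from speed \<open>N\<close> against a logarithm of
  order \<open>2 * ln N\<close>. The first term collects the constants of both stages, with
  \<open>N + 1\<close> in place of \<open>N\<close> so that the first stage is covered when
  \<open>N = 0\<close>.\<close>

definition particle_cost :: "nat \<Rightarrow> real" where
  "particle_cost N = 2 * (real N + 1) * (\<bar>ln (2 / lam_lo)\<bar> + 1) + 4 * vtheta N"

lemma particle_cost_nonneg: "0 \<le> particle_cost N"
  using vtheta_nonneg by (simp add: particle_cost_def)

lemma dparticle_bound:
  assumes t: "0 < t" "t < 2" "t \<notin> \<rat>" and \<alpha>: "\<alpha> \<in> C0"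
  shows "pairing \<alpha> (dparticle x t)
      - measure_pmf.expectation (particle x t) (edge_sum (\<lambda>z w. exp (\<alpha> w - \<alpha> z) * rate_lo z w))
    \<le> particle_cost (snd x)"
proof -
  define N where "N = snd x"
  define y where "y = clock N t"
  define m where "m = nat \<lfloor>y\<rfloor>"
  define s where "s = frac y"
  define r where "r = particle_rate N t"
  let ?i = "site (fst x) m" and ?j = "site (fst x) (Suc m)"
  let ?L = "\<bar>ln (2 / lam_lo)\<bar>"
  let ?G = "edge_sum (\<lambda>z w. exp (\<alpha> w - \<alpha> z) * rate_lo z w)"
  have t1: "t \<noteq> 1" using t(3) by auto
  have s: "0 \<le> s" "s < 1" by (auto simp: s_def frac_lt_1)
  have ym: "real m \<le> y" "y < real m + 1"
    using clock_nonneg[of N t] by (auto simp: m_def y_def of_nat_nat)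
  have r: "0 \<le> r" by (simp add: r_def particle_rate_def)
  have "dparticle x t = (\<lambda>z. 2 * (1 - s) * r * (of_bool (?j = z) - of_bool (?i = z)))"
    by (simp add: dparticle_def fun_eq_iff Let_def N_def y_def m_def s_def r_def)
  then have P: "pairing \<alpha> (dparticle x t) = 2 * (1 - s) * r * (\<alpha> ?j - \<alpha> ?i)"
    by (simp only: pairing_of_bool_diff[OF \<alpha>])
  have "particle x t = two_point ((1 - s)\<^sup>2) ?i ?j"
    by (simp add: particle_def Let_def N_def y_def m_def s_def)
  then have E: "(1 - s)\<^sup>2 * ?G ?i \<le> measure_pmf.expectation (particle x t) ?G"
    using expectation_two_point_ge[of "(1 - s)\<^sup>2" ?G ?i ?j] frac_weight[of y] exp_edge_sum_nonneg
    by (simp add: s_def)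
  have nn: "0 \<le> (1 - s)\<^sup>2 * ?G ?i" using exp_edge_sum_nonneg by simp
  have main: "pairing \<alpha> (dparticle x t) - measure_pmf.expectation (particle x t) ?G
      \<le> 2 * r * (\<bar>ln (2 * r / rate_lo ?i ?j)\<bar> + 1)" if "(?i, ?j) \<in> edges" "0 < r"
  proof -
    have Gij: "exp (\<alpha> ?j - \<alpha> ?i) * rate_lo ?i ?j \<le> ?G ?i"
    proof -
      have nonneg: "0 \<le> exp (\<alpha> w - \<alpha> z) * rate_lo z w" for z w
        using rate_lo(2)[of z w] by simp
      \<comment> \<open>Only the edge in use matters; the term of the other outgoing edge, if any,
        is nonnegative.\<close>
      have "?j = Suc ?i \<or> ?j = 0 \<and> ?i \<noteq> 0" using that(1) by (auto simp: edges_def)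
      then show ?thesis
        using nonneg[of 0 ?i] nonneg[of "Suc ?i" ?i] by (auto simp: edge_sum)
    qed
    have "(1 - s)\<^sup>2 * (exp (\<alpha> ?j - \<alpha> ?i) * rate_lo ?i ?j) \<le> (1 - s)\<^sup>2 * ?G ?i"
      by (intro mult_left_mono Gij) simp
    then show ?thesis
      using transfer_cost_bound[OF that(2) rate_lo(2)[of ?i ?j] s, of "\<alpha> ?j - \<alpha> ?i"] E
      unfolding P by linarith
  qed
  have "pairing \<alpha> (dparticle x t) - measure_pmf.expectation (particle x t) ?G \<le> particle_cost N"
  \<comment> \<open>Before time 1 the edge in use goes from the starting site to 0, or nothing moves
    if the start is 0. Afterwards it goes from some \<open>k\<close> to
    \<open>k + 1\<close>.\<close>
  proof (cases "t < 1")
    case True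
    have "y = t" using True t by (simp add: y_def clock_def clip_eq)
    then have m0: "m = 0" using True t ym by simp
    have r1: "r = 1" using True by (simp add: r_def particle_rate_def)
    have j: "?i = fst x" "?j = 0" by (simp_all add: m0 site_def)
    show ?thesis
    proof (cases "fst x = 0")
      case True
      then have "pairing \<alpha> (dparticle x t) = 0" unfolding P j by simp
      then show ?thesis using E nn particle_cost_nonneg[of N] by linarith
    next
      case False
      then have "(?i, ?j) \<in> edges" unfolding j by (simp add: edges_def)
      then have "pairing \<alpha> (dparticle x t) - measure_pmf.expectation (particle x t) ?G \<le> 2 * (?L + 1)"
        using main r1 by (simp add: j rate_lo_def)
      also have "\<dots> \<le> 2 * (real N + 1) * (?L + 1)" by (intro mult_right_mono) auto
      also have "\<dots> \<le> particle_cost N" using vtheta_nonneg[of N] by (simp add: particle_cost_def)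
      finally show ?thesis .
    qed
  next
    case False
    then have t': "1 < t" using t1 by simp
    have y: "y = 1 + real N * (t - 1)" using t' by (simp add: y_def clock_def clip_eq)
    have rN: "r = real N" using t' by (simp add: r_def particle_rate_def)
    show ?thesis
    proof (cases "N = 0")
      case True
      then have "pairing \<alpha> (dparticle x t) = 0" unfolding P rN by simp
      then show ?thesis using E nn particle_cost_nonneg[of N] by linarith
    next
      case False
      have "0 \<le> real N * (t - 1)" using t' by simp
      then have "0 < m" using y ym by linarith
      then obtain k where k: "m = Suc k" by (cases m) auto
      \<comment> \<open>Since \<open>t < 2\<close> the reading stays below \<open>N + 1\<close>, so
        \<open>k + 1 \<le> N\<close> and \<open>ln (k + 1)\<close> is at most
        \<open>ln N\<close>.\<close>
      have "real N * (t - 1) < real N * 1" using False t by (intro mult_strict_left_mono) auto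
      then have "real m < 1 + real N" using y ym by linarith
      then have kN: "k + 1 \<le> N" using k by simp
      have ij: "?i = k" "?j = Suc k" by (simp_all add: k site_def)
      have "(?i, ?j) \<in> edges" unfolding ij by (simp add: edges_def)
      then have le: "pairing \<alpha> (dparticle x t) - measure_pmf.expectation (particle x t) ?G
          \<le> 2 * real N * (\<bar>ln (2 * real N / (lam_lo / (real k + 1)))\<bar> + 1)"
        using main rN False by (simp add: ij rate_lo_def)
      have "2 * real N / (lam_lo / (real k + 1)) = (2 / lam_lo) * (real N * (real k + 1))" by simp
      also have "ln \<dots> = ln (2 / lam_lo) + (ln (real N) + ln (real k + 1))"
        using lam_lo_pos False by (simp add: ln_mult del: times_divide_eq_left)
      finally have eq: "ln (2 * real N / (lam_lo / (real k + 1))) = ln (2 / lam_lo) + (ln (real N) + ln (real k + 1))" .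
      have "0 \<le> ln (real N)" "0 \<le> ln (real k + 1)" using False by auto
      then have "\<bar>ln (2 * real N / (lam_lo / (real k + 1)))\<bar> \<le> ?L + (ln (real N) + ln (real k + 1))"
        unfolding eq by linarith
      also have "\<dots> \<le> ?L + 2 * ln (real N)"
        using kN by (simp add: add.commute)
      finally have "2 * real N * (\<bar>ln (2 * real N / (lam_lo / (real k + 1)))\<bar> + 1) \<le> 2 * real N * (?L + 2 * ln (real N) + 1)"
        by (intro mult_left_mono) auto
      also have "\<dots> = 2 * real N * (?L + 1) + 4 * vtheta N" by (simp add: vtheta_def algebra_simps)
      also have "\<dots> \<le> particle_cost N"
        unfolding particle_cost_def by (intro add_mono mult_right_mono) (auto simp: vtheta_nonneg)
      finally show ?thesis using le by linarith
    qed
  qed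
  then show ?thesis by (simp add: N_def)
qed

text \<open>The product coupling suffices because the cost of a particle does not depend on its
  starting site. In the constant, the outer 2 is the duration, \<open>2 * lam_up\<close> the price
  of constant rates, and \<open>4 + M\<close> bounds the mean of \<open>N + 1\<close>.\<close>

lemma quasipotential_le:
  assumes "\<xi> \<in> KM M" "0 \<le> M"
  shows "quasipotential lam \<nu> \<xi>
    \<le> ennreal (2 * (2 * lam_up + (2 * (4 + M) * (\<bar>ln (2 / lam_lo)\<bar> + 1) + 4 * M)))"
proof -
  let ?L = "\<bar>ln (2 / lam_lo)\<bar>"
  let ?P = "pair_pmf \<nu> \<xi>"
  define \<phi> where "\<phi> t = bind_pmf ?P (\<lambda>x. particle x t)" for t
  note v = KM_vtheta[OF assms]
  have iN: "integrable (measure_pmf \<xi>) (\<lambda>N. real N)"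
  proof (rule Bochner_Integration.integrable_bound)
    show "integrable (measure_pmf \<xi>) (\<lambda>N. 3 + vtheta N)" using v(1) by simp
  qed (use le_vtheta vtheta_nonneg in auto)
  have snd: "integrable (measure_pmf ?P) (\<lambda>x. f (snd x))"
    "measure_pmf.expectation ?P (\<lambda>x. f (snd x)) = measure_pmf.expectation \<xi> f"
    if "integrable (measure_pmf \<xi>) f" for f :: "nat \<Rightarrow> real"
  proof -
    have "integrable (measure_pmf (map_pmf snd ?P)) f" using that by (simp add: map_snd_pair_pmf)
    then show "integrable (measure_pmf ?P) (\<lambda>x. f (snd x))" by simp
    have "measure_pmf.expectation (map_pmf snd ?P) f = measure_pmf.expectation \<xi> f"
      by (simp only: map_snd_pair_pmf)
    then show "measure_pmf.expectation ?P (\<lambda>x. f (snd x)) = measure_pmf.expectation \<xi> f" by simp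
  qed
  have icost: "integrable (measure_pmf \<xi>) particle_cost"
    unfolding particle_cost_def[abs_def] using iN v(1) by simp
  have "measure_pmf.expectation \<xi> particle_cost
      \<le> measure_pmf.expectation \<xi> (\<lambda>N. 2 * (4 + vtheta N) * (?L + 1) + 4 * vtheta N)"
  proof (intro integral_mono icost)
    show "integrable (measure_pmf \<xi>) (\<lambda>N. 2 * (4 + vtheta N) * (?L + 1) + 4 * vtheta N)"
      using v(1) by simp
    show "particle_cost N \<le> 2 * (4 + vtheta N) * (?L + 1) + 4 * vtheta N" for N
      unfolding particle_cost_def using le_vtheta[of N] vtheta_nonneg[of N]
      by (intro add_mono mult_right_mono) auto
  qed
  also have "\<dots> = 2 * (4 + measure_pmf.expectation \<xi> vtheta) * (?L + 1) + 4 * measure_pmf.expectation \<xi> vtheta"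
    using v(1) by simp
  also have "\<dots> \<le> 2 * (4 + M) * (?L + 1) + 4 * M"
    using v(2) by (intro add_mono mult_right_mono) auto
  finally have cost: "measure_pmf.expectation \<xi> particle_cost \<le> 2 * (4 + M) * (?L + 1) + 4 * M" .
  note mix = mixture_action_le[of 2 ?P "\<lambda>x. 8 * (real (snd x) + 1)" "\<lambda>x. particle_cost (snd x)"
      particle "\<rat>" dparticle, folded \<phi>_def]
  have K: "integrable (measure_pmf ?P) (\<lambda>x. 8 * (real (snd x) + 1))"
    using snd(1)[OF iN] by simp
  have cadlag: "cadlag_path 2 \<phi>"
    by (rule mix(1)) (use K snd(1)[OF icost] countable_rat pmf_particle_lipschitz particle_has_derivative dparticle_bound in auto)
  have act: "action lam 2 \<phi> (\<phi> 0) \<le> ennreal (2 * lam_up + measure_pmf.expectation ?P (\<lambda>x. particle_cost (snd x))) * ennreal 2"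
    by (rule mix(2)) (use K snd(1)[OF icost] countable_rat pmf_particle_lipschitz particle_has_derivative dparticle_bound in auto)
  have c0: "clock N 0 = 0" for N by (simp add: clock_def clip_eq)
  \<comment> \<open>Position \<open>N\<close> is reached at reading \<open>N + 1\<close>, since one
    unit of the clock is spent on the move to 0. Integer readings have fractional part 0 and hence
    give point masses.\<close>
  have c2: "clock N 2 = of_nat (Suc N)" for N by (simp add: clock_def clip_eq)
  have "\<phi> 0 = map_pmf fst ?P"
    unfolding \<phi>_def map_pmf_def
    by (intro bind_pmf_cong refl) (simp add: particle_def c0 two_point_1 site_def)
  then have start: "\<phi> 0 = \<nu>" by (simp add: map_fst_pair_pmf)
  have "\<phi> 2 = map_pmf snd ?P"
    unfolding \<phi>_def map_pmf_def
    by (intro bind_pmf_cong refl) (simp only: particle_def c2 Let_def frac_def floor_of_nat of_int_of_nat_eq diff_self nat_int, simp add: two_point_1 site_def)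
  then have stop: "\<phi> 2 = \<xi>" by (simp add: map_snd_pair_pmf)
  have "quasipotential lam \<nu> \<xi> \<le> action lam 2 \<phi> \<nu>"
    unfolding quasipotential_def
    by (intro Inf_lower CollectI exI[of _ 2] exI[of _ \<phi>]) (simp add: cadlag start stop)
  also have "\<dots> \<le> ennreal (2 * lam_up + measure_pmf.expectation \<xi> particle_cost) * ennreal 2"
    using act unfolding start snd(2)[OF icost] .
  also have "\<dots> = ennreal (2 * (2 * lam_up + measure_pmf.expectation \<xi> particle_cost))"
    by (subst ennreal_mult''[symmetric]) (simp_all add: mult.commute)
  also have "\<dots> \<le> ennreal (2 * (2 * lam_up + (2 * (4 + M) * (?L + 1) + 4 * M)))"
    using cost by (intro ennreal_leI) simp
  finally show ?thesis .
qed

end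

section \<open>Both implications and the uniform bound, starting from the equilibrium\<close>

theorem lemma5p2:
  fixes lam :: "nat \<Rightarrow> nat \<Rightarrow> nat pmf \<Rightarrow> real"
    and lam_up lam_lo :: real
    and \<xi>s :: "nat pmf"
  assumes lam_nonneg: "\<And>z z' \<xi>. (z, z') \<in> edges \<Longrightarrow> lam z z' \<xi> \<ge> 0"
    and pos: "lam_up > 0" "lam_lo > 0"
    and rate_up: "\<And>\<xi> z. lam_lo / (real z + 1) \<le> lam z (z + 1) \<xi>
                       \<and> lam z (z + 1) \<xi> \<le> lam_up / (real z + 1)"
    and rate_zero: "\<And>\<xi> z. z \<noteq> 0 \<Longrightarrow> lam_lo \<le> lam z 0 \<xi> \<and> lam z 0 \<xi> \<le> lam_up"
    and lipschitz: "\<exists>L. \<forall>\<xi> \<eta>.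
        (\<forall>z. \<bar>(real z + 1) * lam z (z + 1) \<xi> - (real z + 1) * lam z (z + 1) \<eta>\<bar> \<le> L * tv_dist \<xi> \<eta>) \<and>
        (\<forall>z. z \<noteq> 0 \<longrightarrow> \<bar>lam z 0 \<xi> - lam z 0 \<eta>\<bar> \<le> L * tv_dist \<xi> \<eta>)"
    and equilibrium: "glob_asymp_stable_equilibrium lam \<xi>s"
    and equilibrium_unique: "\<And>\<xi>. glob_asymp_stable_equilibrium lam \<xi> \<Longrightarrow> \<xi> = \<xi>s"
    and moment_finite: "vtheta_moment \<xi>s < \<infinity>"
    and moment_lim: "\<And>M. M > 0 \<Longrightarrow>
        ((\<lambda>t. SUP \<nu>\<in>KM M. vtheta_moment (mv_flow lam \<nu> t)) \<longlongrightarrow> vtheta_moment \<xi>s) at_top"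
  shows "(\<forall>\<xi>. quasipotential lam \<xi>s \<xi> < \<infinity> \<longleftrightarrow> \<xi> \<in> KK) \<and>
         (\<forall>M>0. \<exists>C>0. \<forall>\<xi>\<in>KM M. quasipotential lam \<xi>s \<xi> \<le> ennreal C)"
proof -
  interpret jump_rates lam lam_up lam_lo
    by standard (use pos rate_up rate_zero in auto)
  \<comment> \<open>The explicit constant depends on \<open>M\<close> and the rate bounds only; it
    is positive because \<open>lam_up\<close> is.\<close>
  have bounded: "\<exists>C>0. \<forall>\<xi>\<in>KM M. quasipotential lam \<xi>s \<xi> \<le> ennreal C" if "M > 0" for M
    using quasipotential_le[of _ M \<xi>s] that pos(1)
    by (intro exI[of _ "2 * (2 * lam_up + (2 * (4 + M) * (\<bar>ln (2 / lam_lo)\<bar> + 1) + 4 * M))"] conjI ballI)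
      (auto intro!: add_pos_nonneg)
  have "\<xi> \<in> KK" if "quasipotential lam \<xi>s \<xi> < \<infinity>" for \<xi>
    by (rule quasipotential_finite_imp_KK[OF moment_finite that])
  moreover have "quasipotential lam \<xi>s \<xi> < \<infinity>" if "\<xi> \<in> KK" for \<xi>
  proof -
    obtain M where "1 \<le> M" "\<xi> \<in> KM M" using \<open>\<xi> \<in> KK\<close> by (auto simp: KK_def)
    then have "quasipotential lam \<xi>s \<xi> \<le> ennreal (2 * (2 * lam_up + (2 * (4 + M) * (\<bar>ln (2 / lam_lo)\<bar> + 1) + 4 * M)))"
      by (intro quasipotential_le) auto
    then show ?thesis by (rule le_less_trans) simp
  qed
  ultimately show ?thesis using bounded by blast
qed

end
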